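(* Let $(X,\lambda)$ and $(X',\lambda')$ be weighted polyhedra of the same type and let $f,g:(X,\lambda)\to(X',\lambda')$ be two W-continuous maps such that $f$ is W-homotopic to $g$. Then $f_*=g_*:\mathcal H^W_*(X,\lambda)\to\mathcal H^W_*(X',\lambda')$. In particular, any W-homotopy equivalence between $(X,\lambda)$ and $(X',\lambda')$ induces an isomorphism on weighted singular homology.
   Context: Weighted complexes and polyhedra. An ascending weight on a simplicial complex $K$ is a function $\mu$ assigning a positive integer to each simplex such that $\mu(\sigma')\mid\mu(\sigma)$ whenever $\sigma'$ is a face of $\sigma$; a descending weight satisfies instead $\mu(\sigma)\mid\mu(\sigma')$. A weighted simplicial complex is a simplicial complex with a weight of one of these types. $(K,\mu)$ is divisibly weighted if the vertices of every simplex can be ordered $v_0,\dots,v_k$ with $\mu(v_0)\mid\cdots\mid\mu(v_k)$, and the weight of that simplex is $\mu(v_k)$ if $\mu$ is ascending and $\mu(v_0)$ if $\mu$ is descending. On the geometric realization $|K|\subseteq\mathbb R^N$ put $\lambda_\mu(x)=\mu(\mathrm{Car}_K(x))$, where $\mathrm{Car}_K(x)$ is the unique simplex containing $x$ in the relative interior of its realization. A weighted space is a pair $(X,\lambda)$ with $\lambda:X\to\mathbb Z_+$; isomorphisms are homeomorphisms preserving $\lambda$. A weighted polyhedron is a weighted space isomorphic to some $(|K|,\lambda_\mu)$; its type (ascending/descending) is that of $\mu$. W-continuity. For weighted polyhedra of the same type, a W-continuous map $f:(X,\lambda)\to(X',\lambda')$ is a continuous map such that for all $x$: $\lambda'(f(x))\mid\lambda(x)$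 (ascending type), $\lambda(x)\mid\lambda'(f(x))$ (descending type). W-homotopy. $([0,1],\mathbf 1)$ is the interval with constant weight $1$, and $(X\times[0,1],\lambda\times\mathbf 1)$ has weight $(x,t)\mapsto\lambda(x)$ and the same type as $(X,\lambda)$. $f$ is W-homotopic to $g$ if there is a W-continuous map $H:(X\times[0,1],\lambda\times\mathbf 1)\to(X',\lambda')$ with $H(x,0)=f(x)$ and $H(x,1)=g(x)$ for all $x$. A W-homotopy equivalence is a W-continuous map $f:(X,\lambda)\to(X',\lambda')$ for which there is a W-continuous map $g:(X',\lambda')\to(X,\lambda)$ with $g\circ f$ and $f\circ g$ W-homotopic to $\mathrm{id}_X$ and $\mathrm{id}_{X'}$ respectively. Weighted singular homology. A weighted singular $n$-simplex of $(X,\lambda)$ is a W-continuous map $\theta:(|\Delta^n|,\lambda_\xi)\to(X,\lambda)$, where $\xi$ is a divisible weight on the standard $n$-simplex $\Delta^n$ of the same type as $(X,\lambda)$ ($\xi$ is part of the data). $\mathcal W_n(X,\lambda)$ is the free abelian group on these, with $\partial^\lambda\theta=\sum_{j=0}^n(-1)^jc^\xi_j(\Delta^n)\,\theta|_{\partial_j\Delta^n}$, where $\partial_j\Delta^n$ (the $j$-th facet, with restricted weight) is identified with $\Delta^{n-1}$ and $c^\xi_j(\Delta^n)=\xi(\Delta^n)/\xi(\partial_j\Delta^n)$ in the ascending case, $\xi(\partial_j\Delta^n)/\xi(\Delta^n)$ in the descending case. $\mathcal H^W_*(X,\lambda)$ is its homology. A W-continuous map $f$ induces the chain map $f_\#(\theta)=f\circ\theta$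 (with the same $\xi$) and hence $f_*$ on $\mathcal H^W_*$. *)

theory Defs
  imports "HOL-Homology.Homology"
begin

section \<open>Simplicial complexes and their geometric realizations\<close>

definition is_complex :: "'v set set \<Rightarrow> bool" where
  "is_complex K \<longleftrightarrow> (\<forall>\<sigma>\<in>K. finite \<sigma> \<and> \<sigma> \<noteq> {} \<and> (\<forall>\<tau>. \<tau> \<subseteq> \<sigma> \<and> \<tau> \<noteq> {} \<longrightarrow> \<tau> \<in> K))"

definition std_complex :: "nat \<Rightarrow> nat set set" where
  "std_complex n = {\<sigma>. \<sigma> \<noteq> {} \<and> \<sigma> \<subseteq> {..n}}"

text \<open>Complexes are realized in barycentric coordinates: the vertices are the unit vectors of the
  space of real functions on the vertex type.  For the standard simplex this is the
  \<^const>\<open>standard_simplex\<close> of the library.\<close>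

definition geo_simplex :: "'v set \<Rightarrow> ('v \<Rightarrow> real) set" where
  "geo_simplex \<sigma> = {x. (\<forall>v. 0 \<le> x v) \<and> (\<forall>v. v \<notin> \<sigma> \<longrightarrow> x v = 0) \<and> sum x \<sigma> = 1}"

definition geo_rel_interior :: "'v set \<Rightarrow> ('v \<Rightarrow> real) set" where
  "geo_rel_interior \<sigma> = {x \<in> geo_simplex \<sigma>. \<forall>v\<in>\<sigma>. 0 < x v}"

text \<open>The topology is the coherent (weak) one; it is the subspace topology whenever the complex is
  finite.\<close>

definition realization :: "'v set set \<Rightarrow> ('v \<Rightarrow> real) topology" where
  "realization K = topology (\<lambda>U. U \<subseteq> \<Union>(geo_simplex ` K) \<and>
     (\<forall>\<sigma>\<in>K. openin (subtopology (powertop_real UNIV) (geo_simplex \<sigma>)) (U \<inter> geo_simplex \<sigma>)))"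

definition Car :: "'v set set \<Rightarrow> ('v \<Rightarrow> real) \<Rightarrow> 'v set" where
  "Car K x = (THE \<sigma>. \<sigma> \<in> K \<and> x \<in> geo_rel_interior \<sigma>)"


section \<open>Weights\<close>

datatype wtype = Ascending | Descending

definition wdvd :: "wtype \<Rightarrow> nat \<Rightarrow> nat \<Rightarrow> bool" where
  "wdvd t a b = (case t of Ascending \<Rightarrow> a dvd b | Descending \<Rightarrow> b dvd a)"

definition is_weight :: "wtype \<Rightarrow> 'v set set \<Rightarrow> ('v set \<Rightarrow> nat) \<Rightarrow> bool" where
  "is_weight t K \<mu> \<longleftrightarrow> (\<forall>\<sigma>\<in>K. 0 < \<mu> \<sigma>) \<and>
     (\<forall>\<sigma>\<in>K. \<forall>\<tau>\<in>K. \<tau> \<subseteq> \<sigma> \<longrightarrow> wdvd t (\<mu> \<tau>) (\<mu> \<sigma>))"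

definition divisible_weight :: "wtype \<Rightarrow> 'v set set \<Rightarrow> ('v set \<Rightarrow> nat) \<Rightarrow> bool" where
  "divisible_weight t K \<mu> \<longleftrightarrow> is_weight t K \<mu> \<and>
     (\<forall>\<sigma>\<in>K. \<exists>vs. set vs = \<sigma> \<and> distinct vs \<and> sorted_wrt (\<lambda>u v. \<mu> {u} dvd \<mu> {v}) vs \<and>
        \<mu> \<sigma> = (case t of Ascending \<Rightarrow> \<mu> {last vs} | Descending \<Rightarrow> \<mu> {hd vs}))"

definition realization_weight :: "'v set set \<Rightarrow> ('v set \<Rightarrow> nat) \<Rightarrow> ('v \<Rightarrow> real) \<Rightarrow> nat" where
  "realization_weight K \<mu> x = \<mu> (Car K x)"


section \<open>Weighted spaces, W-continuity and W-homotopy\<close>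

text \<open>A weighted space is given by a topology \<open>X\<close> and a function \<open>l\<close>, of which only the values on
  \<open>topspace X\<close> matter.\<close>

definition weighted_iso ::
  "'a topology \<Rightarrow> ('a \<Rightarrow> nat) \<Rightarrow> 'b topology \<Rightarrow> ('b \<Rightarrow> nat) \<Rightarrow> ('a \<Rightarrow> 'b) \<Rightarrow> bool" where
  "weighted_iso X l X' l' h \<longleftrightarrow> homeomorphic_map X X' h \<and> (\<forall>x\<in>topspace X. l' (h x) = l x)"

text \<open>The first argument only names the type of the vertices of the triangulating complex.  The
  type of a weighted polyhedron is a parameter, since the weight function alone need not
  determine it (a constant weight is both ascending and descending).\<close>

definition weighted_polyhedron ::
  "'v itself \<Rightarrow> wtype \<Rightarrow> 'a topology \<Rightarrow> ('a \<Rightarrow> nat) \<Rightarrow> bool" where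
  "weighted_polyhedron _ t X l \<longleftrightarrow>
     (\<exists>(K :: 'v set set) \<mu> h. is_complex K \<and> is_weight t K \<mu> \<and>
        weighted_iso (realization K) (realization_weight K \<mu>) X l h)"

definition W_continuous ::
  "wtype \<Rightarrow> 'a topology \<Rightarrow> ('a \<Rightarrow> nat) \<Rightarrow> 'b topology \<Rightarrow> ('b \<Rightarrow> nat) \<Rightarrow> ('a \<Rightarrow> 'b) \<Rightarrow> bool" where
  "W_continuous t X l X' l' f \<longleftrightarrow>
     continuous_map X X' f \<and> (\<forall>x\<in>topspace X. wdvd t (l' (f x)) (l x))"

definition W_homotopic ::
  "wtype \<Rightarrow> 'a topology \<Rightarrow> ('a \<Rightarrow> nat) \<Rightarrow> 'b topology \<Rightarrow> ('b \<Rightarrow> nat) \<Rightarrow> ('a \<Rightarrow> 'b) \<Rightarrow> ('a \<Rightarrow> 'b) \<Rightarrow> bool"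
  where
  "W_homotopic t X l X' l' f g \<longleftrightarrow>
     (\<exists>H. W_continuous t (prod_topology X (top_of_set {0..1::real})) (\<lambda>(x, s). l x) X' l' H \<and>
        (\<forall>x\<in>topspace X. H (x, 0) = f x \<and> H (x, 1) = g x))"

definition W_homotopy_equivalence ::
  "wtype \<Rightarrow> 'a topology \<Rightarrow> ('a \<Rightarrow> nat) \<Rightarrow> 'b topology \<Rightarrow> ('b \<Rightarrow> nat) \<Rightarrow> ('a \<Rightarrow> 'b) \<Rightarrow> bool" where
  "W_homotopy_equivalence t X l X' l' f \<longleftrightarrow>
     W_continuous t X l X' l' f \<and>
     (\<exists>g. W_continuous t X' l' X l g \<and>
        W_homotopic t X l X l (g \<circ> f) id \<and> W_homotopic t X' l' X' l' (f \<circ> g) id)"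


section \<open>Weighted singular homology\<close>

text \<open>A weighted singular simplex is a pair of a divisible weight and a map; both are made
  extensional so that the pair is determined by its values on the simplex.\<close>

type_synonym 'a wsimplex = "(nat set \<Rightarrow> nat) \<times> ((nat \<Rightarrow> real) \<Rightarrow> 'a)"

definition wsimplices :: "wtype \<Rightarrow> nat \<Rightarrow> 'a topology \<Rightarrow> ('a \<Rightarrow> nat) \<Rightarrow> 'a wsimplex set" where
  "wsimplices t n X l = {(\<xi>, \<theta>).
     divisible_weight t (std_complex n) \<xi> \<and> \<xi> \<in> extensional (std_complex n) \<and>
     W_continuous t (realization (std_complex n)) (realization_weight (std_complex n) \<xi>) X l \<theta> \<and>
     \<theta> \<in> extensional (standard_simplex n)}"

definition skip :: "nat \<Rightarrow> nat \<Rightarrow> nat" where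
  "skip j i = (if i < j then i else Suc i)"

text \<open>The \<open>j\<close>-th facet is identified with the standard \<open>(n - 1)\<close>-simplex by the order preserving
  map \<open>skip j\<close> on vertices, whose affine extension is \<^const>\<open>simplical_face\<close>.  Only used for
  \<open>n > 0\<close>.\<close>

definition wface :: "nat \<Rightarrow> nat \<Rightarrow> 'a wsimplex \<Rightarrow> 'a wsimplex" where
  "wface n j = (\<lambda>(\<xi>, \<theta>).
     (restrict (\<lambda>\<sigma>. \<xi> (skip j ` \<sigma>)) (std_complex (n - 1)), singular_face n j \<theta>))"

definition wcoeff :: "wtype \<Rightarrow> nat \<Rightarrow> nat \<Rightarrow> (nat set \<Rightarrow> nat) \<Rightarrow> nat" where
  "wcoeff t n j \<xi> = (case t of
     Ascending \<Rightarrow> \<xi> {..n} div \<xi> ({..n} - {j})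
   | Descending \<Rightarrow> \<xi> ({..n} - {j}) div \<xi> {..n})"

definition wchain_group ::
  "wtype \<Rightarrow> nat \<Rightarrow> 'a topology \<Rightarrow> ('a \<Rightarrow> nat) \<Rightarrow> ('a wsimplex \<Rightarrow>\<^sub>0 int) monoid" where
  "wchain_group t n X l = free_Abelian_group (wsimplices t n X l)"

definition wboundary :: "wtype \<Rightarrow> nat \<Rightarrow> ('a wsimplex \<Rightarrow>\<^sub>0 int) \<Rightarrow> ('a wsimplex \<Rightarrow>\<^sub>0 int)" where
  "wboundary t n c = (if n = 0 then 0 else
     frag_extend (\<lambda>s. \<Sum>j\<le>n.
       frag_cmul ((-1) ^ j * int (wcoeff t n j (fst s))) (frag_of (wface n j s))) c)"

definition wcycles :: "wtype \<Rightarrow> nat \<Rightarrow> 'a topology \<Rightarrow> ('a \<Rightarrow> nat) \<Rightarrow> ('a wsimplex \<Rightarrow>\<^sub>0 int) set" where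
  "wcycles t n X l = {c \<in> carrier (wchain_group t n X l). wboundary t n c = 0}"

definition wboundaries ::
  "wtype \<Rightarrow> nat \<Rightarrow> 'a topology \<Rightarrow> ('a \<Rightarrow> nat) \<Rightarrow> ('a wsimplex \<Rightarrow>\<^sub>0 int) set" where
  "wboundaries t n X l = wboundary t (Suc n) ` carrier (wchain_group t (Suc n) X l)"

definition wcycle_group ::
  "wtype \<Rightarrow> nat \<Rightarrow> 'a topology \<Rightarrow> ('a \<Rightarrow> nat) \<Rightarrow> ('a wsimplex \<Rightarrow>\<^sub>0 int) monoid" where
  "wcycle_group t n X l = (wchain_group t n X l)\<lparr>carrier := wcycles t n X l\<rparr>"

definition whomology_group ::
  "wtype \<Rightarrow> nat \<Rightarrow> 'a topology \<Rightarrow> ('a \<Rightarrow> nat) \<Rightarrow> ('a wsimplex \<Rightarrow>\<^sub>0 int) set monoid" where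
  "whomology_group t n X l = wcycle_group t n X l Mod wboundaries t n X l"

definition wchain_map ::
  "nat \<Rightarrow> ('a \<Rightarrow> 'b) \<Rightarrow> ('a wsimplex \<Rightarrow>\<^sub>0 int) \<Rightarrow> ('b wsimplex \<Rightarrow>\<^sub>0 int)" where
  "wchain_map n f = frag_extend (\<lambda>(\<xi>, \<theta>). frag_of (\<xi>, simplex_map n f \<theta>))"

text \<open>For W-continuous \<open>f\<close> all the cosets in the union below coincide.\<close>

definition whom_induced ::
  "wtype \<Rightarrow> nat \<Rightarrow> 'a topology \<Rightarrow> ('a \<Rightarrow> nat) \<Rightarrow> 'b topology \<Rightarrow> ('b \<Rightarrow> nat) \<Rightarrow> ('a \<Rightarrow> 'b) \<Rightarrow>
   ('a wsimplex \<Rightarrow>\<^sub>0 int) set \<Rightarrow> ('b wsimplex \<Rightarrow>\<^sub>0 int) set" where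
  "whom_induced t n X l X' l' f = (\<lambda>C \<in> carrier (whomology_group t n X l).
     \<Union>c\<in>C. wboundaries t n X' l' #>\<^bsub>wcycle_group t n X' l'\<^esub> wchain_map n f c)"


section \<open>Basic facts\<close>

lemma openin_realization:
  "openin (realization K) U \<longleftrightarrow> U \<subseteq> \<Union>(geo_simplex ` K) \<and>
     (\<forall>\<sigma>\<in>K. openin (subtopology (powertop_real UNIV) (geo_simplex \<sigma>)) (U \<inter> geo_simplex \<sigma>))"
proof -
  have "istopology (\<lambda>U. U \<subseteq> \<Union>(geo_simplex ` K) \<and>
     (\<forall>\<sigma>\<in>K. openin (subtopology (powertop_real UNIV) (geo_simplex \<sigma>)) (U \<inter> geo_simplex \<sigma>)))"
    unfolding istopology_def
  proof (intro conjI allI impI ballI)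
    fix S T \<sigma> assume a: "S \<subseteq> \<Union>(geo_simplex ` K) \<and> (\<forall>\<sigma>\<in>K. openin (subtopology (powertop_real UNIV) (geo_simplex \<sigma>)) (S \<inter> geo_simplex \<sigma>))"
      "T \<subseteq> \<Union>(geo_simplex ` K) \<and> (\<forall>\<sigma>\<in>K. openin (subtopology (powertop_real UNIV) (geo_simplex \<sigma>)) (T \<inter> geo_simplex \<sigma>))" "\<sigma> \<in> K"
    have "S \<inter> T \<inter> geo_simplex \<sigma> = (S \<inter> geo_simplex \<sigma>) \<inter> (T \<inter> geo_simplex \<sigma>)" by auto
    then show "openin (subtopology (powertop_real UNIV) (geo_simplex \<sigma>)) (S \<inter> T \<inter> geo_simplex \<sigma>)"
      using a by (metis openin_Int)
  next
    fix \<K> \<sigma> assume a: "\<forall>U\<in>\<K>. U \<subseteq> \<Union>(geo_simplex ` K) \<and> (\<forall>\<sigma>\<in>K. openin (subtopology (powertop_real UNIV) (geo_simplex \<sigma>)) (U \<inter> geo_simplex \<sigma>))" "\<sigma> \<in> K"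
    have "\<Union>\<K> \<inter> geo_simplex \<sigma> = (\<Union>U\<in>\<K>. U \<inter> geo_simplex \<sigma>)" by auto
    moreover have "openin (subtopology (powertop_real UNIV) (geo_simplex \<sigma>)) (\<Union>U\<in>\<K>. U \<inter> geo_simplex \<sigma>)"
      by (rule openin_Union) (use a in blast)
    ultimately show "openin (subtopology (powertop_real UNIV) (geo_simplex \<sigma>)) (\<Union>\<K> \<inter> geo_simplex \<sigma>)"
      by simp
  qed auto
  then show ?thesis
    by (simp add: realization_def)
qed

lemma topspace_realization: "topspace (realization K) = \<Union>(geo_simplex ` K)"
proof (rule antisym)
  show "topspace (realization K) \<subseteq> \<Union>(geo_simplex ` K)"
    using openin_topspace openin_realization by blast
  have "\<Union>(geo_simplex ` K) \<inter> geo_simplex \<sigma> = geo_simplex \<sigma>" if "\<sigma> \<in> K" for \<sigma> using that by auto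
  then have "openin (realization K) (\<Union>(geo_simplex ` K))"
    unfolding openin_realization by (simp add: openin_subtopology_refl)
  then show "\<Union>(geo_simplex ` K) \<subseteq> topspace (realization K)"
    by (simp add: openin_subset)
qed

lemma geo_simplex_mono: "\<sigma> \<subseteq> \<tau> \<Longrightarrow> finite \<tau> \<Longrightarrow> geo_simplex \<sigma> \<subseteq> geo_simplex \<tau>"
proof
  fix x assume a: "\<sigma> \<subseteq> \<tau>" "finite \<tau>" "x \<in> geo_simplex \<sigma>"
  then have "sum x \<tau> = sum x \<sigma>"
    by (intro sum.mono_neutral_right) (auto simp: geo_simplex_def)
  then show "x \<in> geo_simplex \<tau>" using a by (auto simp: geo_simplex_def)
qed

lemma geo_simplex_std: "geo_simplex {..n} = standard_simplex n"
proof -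
  have "x i \<le> 1" if "\<forall>v. 0 \<le> x v" "\<forall>v. v \<notin> {..n} \<longrightarrow> x v = 0" "sum x {..n} = 1" for x :: "nat \<Rightarrow> real" and i
    using that member_le_sum[of i "{..n}" x] by (cases "i \<in> {..n}") auto
  then show ?thesis
    by (auto simp: geo_simplex_def standard_simplex_def)
qed

lemma realization_std_complex:
  "realization (std_complex n) = subtopology (powertop_real UNIV) (standard_simplex n)"
proof -
  have top: "{..n} \<in> std_complex n" by (auto simp: std_complex_def)
  have sub: "geo_simplex \<sigma> \<subseteq> standard_simplex n" if "\<sigma> \<in> std_complex n" for \<sigma>
    using geo_simplex_mono[of \<sigma> "{..n}"] that by (auto simp: std_complex_def geo_simplex_std)
  have U: "\<Union>(geo_simplex ` std_complex n) = standard_simplex n"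
    using sub top by (fastforce simp: geo_simplex_std[symmetric])
  have "openin (realization (std_complex n)) S \<longleftrightarrow>
        openin (subtopology (powertop_real UNIV) (standard_simplex n)) S" for S
  proof
    assume S: "openin (realization (std_complex n)) S"
    then have *: "S \<subseteq> \<Union>(geo_simplex ` std_complex n)"
      and **: "openin (subtopology (powertop_real UNIV) (geo_simplex {..n})) (S \<inter> geo_simplex {..n})"
      using top unfolding openin_realization by auto
    from * have "S \<inter> standard_simplex n = S" unfolding U by auto
    with ** show "openin (subtopology (powertop_real UNIV) (standard_simplex n)) S"
      by (simp add: geo_simplex_std)
  next
    assume S: "openin (subtopology (powertop_real UNIV) (standard_simplex n)) S"
    then obtain T where T: "openin (powertop_real UNIV) T" "S = T \<inter> standard_simplex n"
      by (auto simp: openin_subtopology)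
    have "openin (subtopology (powertop_real UNIV) (geo_simplex \<sigma>)) (S \<inter> geo_simplex \<sigma>)" if "\<sigma> \<in> std_complex n" for \<sigma>
      unfolding openin_subtopology using T sub[OF that] by (intro exI[of _ T]) auto
    then show "openin (realization (std_complex n)) S"
      unfolding openin_realization U using T by auto
  qed
  then show ?thesis by (simp add: topology_eq)
qed

lemma Car_eq:
  assumes "is_complex K" "x \<in> \<Union>(geo_simplex ` K)"
  shows "Car K x = {v. x v \<noteq> 0} \<and> {v. x v \<noteq> 0} \<in> K \<and> x \<in> geo_rel_interior {v. x v \<noteq> 0}"
proof -
  obtain \<sigma> where s: "\<sigma> \<in> K" "x \<in> geo_simplex \<sigma>" using assms by auto
  have fin: "finite \<sigma>" using assms(1) s(1) unfolding is_complex_def by blast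
  let ?\<tau> = "{v. x v \<noteq> 0}"
  have x: "0 \<le> x v" "v \<notin> \<sigma> \<Longrightarrow> x v = 0" "sum x \<sigma> = 1" for v
    using s(2) by (simp_all add: geo_simplex_def)
  have sub: "?\<tau> \<subseteq> \<sigma>" using x(2) by blast
  have "sum x ?\<tau> = sum x \<sigma>"
    using sub fin by (intro sum.mono_neutral_left) auto
  then have sm: "sum x ?\<tau> = 1" by (simp only: x(3))
  have "?\<tau> \<noteq> {}"
  proof
    assume "?\<tau> = {}"
    with sm show False by (simp only: sum.empty)
  qed
  then have K: "?\<tau> \<in> K" using assms(1) s(1) sub unfolding is_complex_def by blast
  have i: "x \<in> geo_rel_interior ?\<tau>"
  proof -
    have "0 < x v" if "v \<in> ?\<tau>" for v using that x(1)[of v] by simp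
    then show ?thesis using x(1) sm unfolding geo_rel_interior_def geo_simplex_def by simp
  qed
  have u: "\<rho> = ?\<tau>" if "x \<in> geo_rel_interior \<rho>" for \<rho>
  proof -
    have "v \<in> \<rho> \<longleftrightarrow> x v \<noteq> 0" for v
    proof (cases "v \<in> \<rho>")
      case True
      then have "0 < x v" using that unfolding geo_rel_interior_def by blast
      with True show ?thesis by simp
    next
      case False
      then have "x v = 0" using that unfolding geo_rel_interior_def geo_simplex_def by blast
      with False show ?thesis by simp
    qed
    then show ?thesis by blast
  qed
  have "Car K x = ?\<tau>" unfolding Car_def
    by (rule the_equality, rule conjI[OF K i], erule conjE, rule u)
  then show ?thesis using K i by blast
qed

lemma wsimplices_imp_singular_simplex:
  "(\<xi>, \<theta>) \<in> wsimplices t n X l \<Longrightarrow> singular_simplex n X \<theta>"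
  by (simp add: wsimplices_def W_continuous_def singular_simplex_def realization_std_complex)

lemma skip_inj: "inj (skip j)" by (auto simp: inj_on_def skip_def split: if_splits)

lemma skip_std: "\<sigma> \<in> std_complex n \<Longrightarrow> skip j ` \<sigma> \<in> std_complex (Suc n)"
  by (fastforce simp: std_complex_def skip_def)

lemma supp_face: "{i. simplical_face j x i \<noteq> (0::real)} = skip j ` {i. x i \<noteq> 0}" (is "?A = _ ` ?B")
proof (intro equalityI subsetI)
  fix i assume "i \<in> ?A"
  then show "i \<in> skip j ` ?B"
  proof (cases "i < j")
    case False
    then have "i = skip j (i - 1)" "x (i - 1) \<noteq> 0"
      using \<open>i \<in> ?A\<close> by (auto simp: simplical_face_def skip_def split: if_splits)
    then show ?thesis by blast
  next
    case True
    then have "i = skip j i" "x i \<noteq> 0"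
      using \<open>i \<in> ?A\<close> by (auto simp: simplical_face_def skip_def)
    then show ?thesis by blast
  qed
qed (auto simp: simplical_face_def skip_def split: if_splits)

lemma is_complex_std: "is_complex (std_complex n)"
  by (auto simp: is_complex_def std_complex_def intro: finite_subset)

lemma std_Un: "\<Union>(geo_simplex ` std_complex n) = standard_simplex n"
  using topspace_realization[of "std_complex n"] by (simp only: realization_std_complex topspace_standard_simplex)

lemma wface_in:
  assumes s: "s \<in> wsimplices t (Suc n) X l" and j: "j \<le> Suc n"
  shows "wface (Suc n) j s \<in> wsimplices t n X l"
proof -
  obtain \<xi> \<theta> where st: "s = (\<xi>,\<theta>)" by force
  have d: "divisible_weight t (std_complex (Suc n)) \<xi>" 
    and c: "W_continuous t (realization (std_complex (Suc n))) (realization_weight (std_complex (Suc n)) \<xi>) X l \<theta>"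
    using s st by (auto simp: wsimplices_def)
  let ?\<eta> = "restrict (\<lambda>\<sigma>. \<xi> (skip j ` \<sigma>)) (std_complex n)"
  have w: "is_weight t (std_complex n) ?\<eta>"
  proof -
    have "is_weight t (std_complex (Suc n)) \<xi>" using d by (simp add: divisible_weight_def)
    then show ?thesis using skip_std[of _ n j] by (simp add: is_weight_def image_mono)
  qed
  have "\<exists>vs. set vs = \<sigma> \<and> distinct vs \<and> sorted_wrt (\<lambda>u v. ?\<eta> {u} dvd ?\<eta> {v}) vs \<and>
        ?\<eta> \<sigma> = (case t of Ascending \<Rightarrow> ?\<eta> {last vs} | Descending \<Rightarrow> ?\<eta> {hd vs})" if \<sigma>: "\<sigma> \<in> std_complex n" for \<sigma>
  proof -
    obtain us where us: "set us = skip j ` \<sigma>" "distinct us" "sorted_wrt (\<lambda>u v. \<xi> {u} dvd \<xi> {v}) us"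
      "\<xi> (skip j ` \<sigma>) = (case t of Ascending \<Rightarrow> \<xi> {last us} | Descending \<Rightarrow> \<xi> {hd us})"
      using d skip_std[OF \<sigma>, of j] unfolding divisible_weight_def by blast
    define vs where "vs = map (inv_into UNIV (skip j)) us"
    have uv: "us = map (skip j) vs"
      using us(1) by (auto simp: vs_def map_idI f_inv_into_f map_map intro!: map_idI[symmetric])
    have sv: "set vs = \<sigma>" using us(1) by (force simp: vs_def image_image inv_f_f[OF skip_inj])
    have ne: "vs \<noteq> []" using sv \<sigma> by (auto simp: std_complex_def)
    have e: "?\<eta> {v} = \<xi> {skip j v}" if "v \<in> set vs" for v
      using that sv \<sigma> by (auto simp: std_complex_def)
    show ?thesis
    proof (intro exI[of _ vs] conjI)
      show "distinct vs" using us(2) uv distinct_map by auto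
      show "sorted_wrt (\<lambda>u v. ?\<eta> {u} dvd ?\<eta> {v}) vs"
        using us(3) unfolding uv sorted_wrt_map by (rule sorted_wrt_mono_rel[rotated]) (metis e)
      show "?\<eta> \<sigma> = (case t of Ascending \<Rightarrow> ?\<eta> {last vs} | Descending \<Rightarrow> ?\<eta> {hd vs})"
        using us(4) ne \<sigma> e[of "last vs"] e[of "hd vs"] by (cases t) (auto simp: uv last_map hd_map)
    qed (rule sv)
  qed
  with w have dd: "divisible_weight t (std_complex n) ?\<eta>"
    unfolding divisible_weight_def by blast
  have sf: "singular_simplex n X (singular_face (Suc n) j \<theta>)"
    using singular_simplex_singular_face[of "Suc n" X \<theta> j] wsimplices_imp_singular_simplex[of \<xi> \<theta> t "Suc n" X l] s st j by auto
  have "wdvd t (l (singular_face (Suc n) j \<theta> x)) (realization_weight (std_complex n) ?\<eta> x)"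
    if x: "x \<in> standard_simplex n" for x
  proof -
    have y: "simplical_face j x \<in> standard_simplex (Suc n)"
      using simplical_face_in_standard_simplex[of "Suc n" j x] x j by auto
    have 1: "wdvd t (l (\<theta> (simplical_face j x))) (realization_weight (std_complex (Suc n)) \<xi> (simplical_face j x))"
      using c y by (auto simp: W_continuous_def topspace_realization std_Un)
    have 2: "Car (std_complex n) x = {i. x i \<noteq> 0}" "{i. x i \<noteq> 0} \<in> std_complex n"
      using Car_eq[OF is_complex_std, of x n] x unfolding std_Un by simp_all
    have 3: "Car (std_complex (Suc n)) (simplical_face j x) = skip j ` {i. x i \<noteq> 0}"
      using Car_eq[OF is_complex_std, of "simplical_face j x" "Suc n"] y unfolding std_Un supp_face by simp
    show ?thesis using 1 2 3 x by (simp add: realization_weight_def singular_face_def)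
  qed
  with sf have "W_continuous t (realization (std_complex n)) (realization_weight (std_complex n) ?\<eta>) X l (singular_face (Suc n) j \<theta>)"
    by (auto simp: W_continuous_def topspace_realization std_Un singular_simplex_def realization_std_complex)
  then show ?thesis using dd sf by (auto simp: wsimplices_def wface_def st singular_simplex_def)
qed


lemma wcoeff_wface:
  assumes "is_weight t (std_complex (Suc n)) \<xi>" "j \<le> Suc n" "i \<le> n" "0 < n"
  shows "wcoeff t (Suc n) j \<xi> * wcoeff t n i (fst (wface (Suc n) j (\<xi>, \<theta>))) =
    (case t of Ascending \<Rightarrow> \<xi> {..Suc n} div \<xi> ({..Suc n} - {j, skip j i})
            | Descending \<Rightarrow> \<xi> ({..Suc n} - {j, skip j i}) div \<xi> {..Suc n})"
proof -
  have sk: "skip j ` {..n} = {..Suc n} - {j}"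
  proof (intro equalityI subsetI)
    fix k assume k: "k \<in> {..Suc n} - {j}"
    show "k \<in> skip j ` {..n}"
    proof (cases "k < j")
      case True then show ?thesis using k assms(2) by (intro image_eqI[of _ _ k]) (auto simp: skip_def)
    next
      case False then show ?thesis using k assms(2) by (intro image_eqI[of _ _ "k-1"]) (auto simp: skip_def)
    qed
  qed (auto simp: skip_def)
  have sk2: "skip j ` ({..n} - {i}) = {..Suc n} - {j, skip j i}"
    using sk by (auto simp: image_set_diff[OF skip_inj])
  have m: "{..n} \<in> std_complex n" "{..n} - {i} \<in> std_complex n"
    using assms by (auto simp: std_complex_def)
  let ?A = "{..Suc n}" and ?B = "{..Suc n} - {j}" and ?C = "{..Suc n} - {j, skip j i}"
  have A: "?A \<in> std_complex (Suc n)" by (auto simp: std_complex_def)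
  have B: "?B \<in> std_complex (Suc n)" using skip_std[OF m(1), of j] sk by simp
  have C: "?C \<in> std_complex (Suc n)" using skip_std[OF m(2), of j] sk2 by simp
  have p: "\<And>\<sigma>. \<sigma> \<in> std_complex (Suc n) \<Longrightarrow> 0 < \<xi> \<sigma>"
    and d: "\<And>\<sigma> \<tau>. \<sigma> \<in> std_complex (Suc n) \<Longrightarrow> \<tau> \<in> std_complex (Suc n) \<Longrightarrow> \<tau> \<subseteq> \<sigma> \<Longrightarrow> wdvd t (\<xi> \<tau>) (\<xi> \<sigma>)"
    using assms(1) unfolding is_weight_def by simp_all
  have d1: "wdvd t (\<xi> ?B) (\<xi> ?A)" by (rule d[OF A B]) (rule Diff_subset)
  have d2: "wdvd t (\<xi> ?C) (\<xi> ?B)" by (rule d[OF B C]) blast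
  have q: "a div b * (b div c) = a div c" if "c dvd b" "b dvd a" "0 < a" for a b c :: nat
    using that by (metis div_mult_swap dvd_div_mult_self)
  have r: "wcoeff t n i (fst (wface (Suc n) j (\<xi>, \<theta>))) =
     (case t of Ascending \<Rightarrow> \<xi> ?B div \<xi> ?C | Descending \<Rightarrow> \<xi> ?C div \<xi> ?B)"
    using m by (cases t) (simp_all add: wcoeff_def wface_def sk sk2 restrict_apply')
  show ?thesis
  proof (cases t)
    case Ascending
    then show ?thesis unfolding r using q[of "\<xi> ?C" "\<xi> ?B" "\<xi> ?A"] d1 d2 p[OF A]
      by (simp only: wcoeff_def wdvd_def wtype.case)
  next
    case Descending
    then show ?thesis unfolding r using q[of "\<xi> ?A" "\<xi> ?B" "\<xi> ?C"] d1 d2 p[OF C]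
      by (simp only: wcoeff_def wdvd_def wtype.case mult.commute)
  qed
qed

lemma wface_wface:
  assumes "(\<xi>, \<theta>) \<in> wsimplices t (Suc (Suc n)) X l" "i \<le> j" "j \<le> Suc n"
  shows "wface (Suc n) i (wface (Suc (Suc n)) (Suc j) (\<xi>, \<theta>)) =
         wface (Suc n) j (wface (Suc (Suc n)) i (\<xi>, \<theta>))"
proof -
  have "skip (Suc j) (skip i k) = skip i (skip j k)" for k
    using assms by (auto simp: skip_def)
  then have "skip (Suc j) ` skip i ` \<sigma> = skip i ` skip j ` \<sigma>" for \<sigma> by (simp add: image_image)
  then have 1: "(\<lambda>\<sigma>\<in>std_complex n. (\<lambda>\<sigma>\<in>std_complex (Suc n). \<xi> (skip (Suc j) ` \<sigma>)) (skip i ` \<sigma>)) =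
        (\<lambda>\<sigma>\<in>std_complex n. (\<lambda>\<sigma>\<in>std_complex (Suc n). \<xi> (skip i ` \<sigma>)) (skip j ` \<sigma>))"
    using skip_std by (intro restrict_ext) simp
  have 2: "singular_face (Suc n) i (singular_face (Suc (Suc n)) (Suc j) \<theta>) = singular_face (Suc n) j (singular_face (Suc (Suc n)) i \<theta>)"
  proof
    fix x :: "nat \<Rightarrow> real"
    have "simplical_face (Suc j) (simplical_face i x) = simplical_face i (simplical_face j x)"
      using assms by (fastforce simp: simplical_face_def)
    then show "singular_face (Suc n) i (singular_face (Suc (Suc n)) (Suc j) \<theta>) x = singular_face (Suc n) j (singular_face (Suc (Suc n)) i \<theta>) x"
      using simplical_face_in_standard_simplex[of "Suc n" _ x] assms by (simp add: singular_face_def)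
  qed
  show ?thesis using 1 2 by (simp add: wface_def)
qed

lemma wboundary_wboundary:
  assumes "c \<in> carrier (wchain_group t (Suc (Suc n)) X l)"
  shows "wboundary t (Suc n) (wboundary t (Suc (Suc n)) c) = 0"
proof -
  have "Poly_Mapping.keys c \<subseteq> wsimplices t (Suc (Suc n)) X l"
    using assms by (simp add: wchain_group_def free_Abelian_group_def)
  then show ?thesis
  proof (induction rule: frag_induction)
    case zero
    then show ?case by (simp add: wboundary_def)
  next
    case (diff a b)
    then show ?case by (simp add: wboundary_def frag_extend_diff)
  next
    case (one s)
    obtain \<xi> \<theta> where s: "s = (\<xi>,\<theta>)" by force
    have w: "is_weight t (std_complex (Suc (Suc n))) \<xi>"
      using one s by (auto simp: wsimplices_def divisible_weight_def)
    define K where "K j i = (case t of Ascending \<Rightarrow> \<xi> {..Suc (Suc n)} div \<xi> ({..Suc (Suc n)} - {j, skip j i})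
            | Descending \<Rightarrow> \<xi> ({..Suc (Suc n)} - {j, skip j i}) div \<xi> {..Suc (Suc n)})" for j i
    define F where "F j i = frag_cmul ((-1)^(j+i) * int (K j i)) (frag_of (wface (Suc n) i (wface (Suc (Suc n)) j s)))" for j i
    have "wboundary t (Suc n) (wboundary t (Suc (Suc n)) (frag_of s)) =
       (\<Sum>j\<le>Suc (Suc n). \<Sum>i\<le>Suc n. F j i)"
    proof -
      have e: "((-1) ^ j * int (wcoeff t (Suc (Suc n)) j \<xi>)) * ((-1) ^ i * int (wcoeff t (Suc n) i (fst (wface (Suc (Suc n)) j (\<xi>,\<theta>)))))
          = (-1)^(j+i) * int (K j i)" if "j \<le> Suc (Suc n)" "i \<le> Suc n" for i j
        using wcoeff_wface[OF w that, of \<theta>] by (simp add: K_def power_add ac_simps flip: of_nat_mult)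
      have c: "frag_cmul a (sum f S) = (\<Sum>i\<in>S. frag_cmul a (f i))" for a and f :: "nat \<Rightarrow> 'a wsimplex \<Rightarrow>\<^sub>0 int" and S
        by (rule frag_cmul_sum)
      show ?thesis
        unfolding wboundary_def
        by (simp only: nat.simps if_False frag_extend_of frag_extend_sum[OF finite_atMost] frag_extend_cmul c comp_def)
          (auto simp only: F_def s frag_cmul_cmul e fst_conv atMost_iff intro!: sum.cong)
    qed
    also have "\<dots> = (\<Sum>(j,i)\<in>{..Suc (Suc n)} \<times> {..Suc n}. F j i)"
      by (rule sum.cartesian_product)
    also have "\<dots> = (\<Sum>(j,i)\<in>{(j,i). i < j \<and> j \<le> Suc (Suc n)}. F j i) + (\<Sum>(j,i)\<in>{(j,i). j \<le> i \<and> i \<le> Suc n}. F j i)"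
    proof -
      have "{..Suc (Suc n)} \<times> {..Suc n} = {(j,i). i < j \<and> j \<le> Suc (Suc n)} \<union> {(j,i). j \<le> i \<and> i \<le> Suc n}" by auto
      moreover have "finite {(j,i). i < j \<and> j \<le> Suc (Suc n)}" "finite {(j,i). j \<le> i \<and> i \<le> Suc n}"
        by (rule finite_subset[of _ "{..Suc (Suc n)} \<times> {..Suc (Suc n)}"]; auto)+
      ultimately show ?thesis by (simp add: sum.union_disjoint disjoint_iff)
    qed
    also have "(\<Sum>(j,i)\<in>{(j,i). i < j \<and> j \<le> Suc (Suc n)}. F j i) = (\<Sum>(j,i)\<in>{(j,i). j \<le> i \<and> i \<le> Suc n}. F (Suc i) j)"
      by (rule sum.reindex_bij_witness[of _ "\<lambda>(j,i). (Suc i, j)" "\<lambda>(j,i). (i, j - 1)"]) auto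
    also have "\<dots> = - (\<Sum>(j,i)\<in>{(j,i). j \<le> i \<and> i \<le> Suc n}. F j i)"
    proof -
      have "F (Suc i) j = - F j i" if "j \<le> i" "i \<le> Suc n" for i j
      proof -
        have "{Suc i, skip (Suc i) j} = {j, skip j i}" using that by (auto simp: skip_def)
        then have "K (Suc i) j = K j i" unfolding K_def by (simp only:)
        moreover have "wface (Suc n) j (wface (Suc (Suc n)) (Suc i) s) = wface (Suc n) i (wface (Suc (Suc n)) j s)"
          using wface_wface[of \<xi> \<theta> t n X l j i] one that s by simp
        ultimately show ?thesis by (simp add: F_def add.commute)
      qed
      then show ?thesis by (auto simp: sum_negf[symmetric] intro!: sum.cong)
    qed
    finally show ?case by simp
  qed
qed

end

theory Submission
  imports Defs
begin

text \<open>The classical prism operator works in the weighted setting.  Give each simplex of the standard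
  triangulation of \<open>\<Delta>\<^sup>n \<times> [0,1]\<close> the weight pulled back along the projection to \<open>\<Delta>\<^sup>n\<close>, which is a degeneracy
  on vertices.  The pullback is again divisible, and composing the homotopy with the prism simplices
  keeps W-continuity because the weight of the product ignores the interval.  A facet interior to the
  prism, or its top or bottom, projects onto all of \<open>\<Delta>\<^sup>n\<close> and so has coefficient \<open>1\<close>; the interior ones
  cancel in pairs.  A facet over \<open>\<partial>\<^sub>j\<Delta>\<^sup>n\<close> has the coefficient of \<open>\<partial>\<^sub>j\<Delta>\<^sup>n\<close>.  Hence the usual identity
  \<open>\<partial>P = g\<^sub># - f\<^sub># - P\<partial>\<close> holds with the weighted boundary.\<close>

section \<open>W-continuous maps and weighted singular simplices\<close>

lemma wdvd_refl [simp]: "wdvd t a a"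
  by (cases t) (auto simp: wdvd_def)

lemma wdvd_trans: "wdvd t a b \<Longrightarrow> wdvd t b c \<Longrightarrow> wdvd t a c"
  by (cases t) (auto simp: wdvd_def intro: dvd_trans)

lemma W_continuous_id: "W_continuous t X l X l id"
  by (simp add: W_continuous_def)

lemma W_continuous_compose:
  assumes "W_continuous t X l Y m f" "W_continuous t Y m Z k g"
  shows "W_continuous t X l Z k (g \<circ> f)"
  unfolding W_continuous_def
proof (intro conjI ballI)
  show "continuous_map X Z (g \<circ> f)"
    using assms by (auto simp: W_continuous_def intro: continuous_map_compose)
  fix x assume x: "x \<in> topspace X"
  then have "f x \<in> topspace Y"
    using assms(1) continuous_map_image_subset_topspace by (fastforce simp: W_continuous_def)
  then have "wdvd t (k (g (f x))) (m (f x))" "wdvd t (m (f x)) (l x)"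
    using assms x by (auto simp: W_continuous_def)
  then show "wdvd t (k ((g \<circ> f) x)) (l x)"
    unfolding o_apply by (rule wdvd_trans)
qed

lemma standard_simplex_nonneg: "x \<in> standard_simplex n \<Longrightarrow> 0 \<le> x i"
  by (simp add: standard_simplex_def)

lemma realization_weight_std:
  "x \<in> standard_simplex n \<Longrightarrow> realization_weight (std_complex n) \<xi> x = \<xi> {i. x i \<noteq> 0}"
  using Car_eq[OF is_complex_std, of x n] by (simp add: realization_weight_def std_Un)

lemma support_std_complex: "x \<in> standard_simplex n \<Longrightarrow> {i. x i \<noteq> 0} \<in> std_complex n"
  using Car_eq[OF is_complex_std, of x n] by (simp add: std_Un)

text \<open>The carrier of a point of the standard simplex is its support, so the weight condition
  can be tested on coordinates.\<close>

lemma wsimplices_iff: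
  "(\<xi>, \<theta>) \<in> wsimplices t n X l \<longleftrightarrow>
     divisible_weight t (std_complex n) \<xi> \<and> \<xi> \<in> extensional (std_complex n) \<and>
     singular_simplex n X \<theta> \<and> (\<forall>x\<in>standard_simplex n. wdvd t (l (\<theta> x)) (\<xi> {i. x i \<noteq> 0}))"
  by (auto simp: wsimplices_def W_continuous_def singular_simplex_def realization_std_complex
      realization_weight_std)

lemma wsimplex_map_in:
  assumes "(\<xi>, \<theta>) \<in> wsimplices t n X l" "W_continuous t X l X' l' f"
  shows "(\<xi>, simplex_map n f \<theta>) \<in> wsimplices t n X' l'"
proof -
  have "\<theta> x \<in> topspace X" if "x \<in> standard_simplex n" for x
    using assms(1) that continuous_map_image_subset_topspace
    by (fastforce simp: wsimplices_iff singular_simplex_def)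
  then have "wdvd t (l' (f (\<theta> x))) (\<xi> {i. x i \<noteq> 0})" if "x \<in> standard_simplex n" for x
    using assms that wdvd_trans[of t "l' (f (\<theta> x))" "l (\<theta> x)"] by (auto simp: wsimplices_iff W_continuous_def)
  moreover have "singular_simplex n X' (simplex_map n f \<theta>)"
    using assms by (auto simp: wsimplices_iff W_continuous_def intro: singular_simplex_simplex_map)
  ultimately show ?thesis
    using assms(1) by (simp add: wsimplices_iff simplex_map_def)
qed


section \<open>Pulling back divisible weights along vertex maps\<close>

text \<open>The hypothesis \<open>R x x\<close> covers the case that \<open>x\<close> itself is the
  last entry.\<close>

lemma sorted_wrt_last:
  "sorted_wrt R xs \<Longrightarrow> x \<in> set xs \<Longrightarrow> R x x \<Longrightarrow> R x (last xs)"
  by (induction xs) auto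

lemma sorted_wrt_hd:
  "sorted_wrt R xs \<Longrightarrow> x \<in> set xs \<Longrightarrow> R x x \<Longrightarrow> R (hd xs) x"
  by (cases xs) auto

lemma sorted_wrt_comparable:
  "sorted_wrt R xs \<Longrightarrow> x \<in> set xs \<Longrightarrow> y \<in> set xs \<Longrightarrow> x = y \<or> R x y \<or> R y x"
  by (induction xs) auto

text \<open>The map \<phi> may identify vertices, as degeneracies do, so a vertex order of the image
  cannot just be carried back. The vertices are sorted by the size of their weights instead; the
  linear order on the source type serves to turn the vertex set into a list.\<close>

lemma divisible_weight_pullback:
  fixes \<phi> :: "'u :: linorder \<Rightarrow> 'v"
  assumes L: "is_complex L" and K: "\<And>\<sigma>. \<sigma> \<in> L \<Longrightarrow> \<phi> ` \<sigma> \<in> K"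
    and \<xi>: "divisible_weight t K \<xi>"
  shows "divisible_weight t L (restrict (\<lambda>\<sigma>. \<xi> (\<phi> ` \<sigma>)) L)"
  unfolding divisible_weight_def
proof (intro conjI ballI)
  let ?\<eta> = "restrict (\<lambda>\<sigma>. \<xi> (\<phi> ` \<sigma>)) L"
  have w: "is_weight t K \<xi>"
    using \<xi> by (simp add: divisible_weight_def)
  then have wK: "\<rho> \<in> K \<Longrightarrow> 0 < \<xi> \<rho>"
      "\<rho> \<in> K \<Longrightarrow> \<tau> \<in> K \<Longrightarrow> \<tau> \<subseteq> \<rho> \<Longrightarrow> wdvd t (\<xi> \<tau>) (\<xi> \<rho>)" for \<rho> \<tau>
    unfolding is_weight_def by simp_all
  show "is_weight t L ?\<eta>"
    unfolding is_weight_def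
  proof (intro conjI ballI impI)
    show "wdvd t (?\<eta> \<tau>) (?\<eta> \<sigma>)" if "\<sigma> \<in> L" "\<tau> \<in> L" "\<tau> \<subseteq> \<sigma>" for \<sigma> \<tau>
      using wK(2)[OF K K image_mono] that by simp
  next
    show "0 < ?\<eta> \<sigma>" if "\<sigma> \<in> L" for \<sigma>
      using wK(1)[OF K] that by simp
  qed
  fix \<sigma> assume \<sigma>: "\<sigma> \<in> L"
  have \<sigma>L: "finite \<sigma> \<and> \<sigma> \<noteq> {} \<and> (\<forall>\<tau>. \<tau> \<subseteq> \<sigma> \<and> \<tau> \<noteq> {} \<longrightarrow> \<tau> \<in> L)"
    using L \<sigma> unfolding is_complex_def by (rule bspec)
  then have fin: "finite \<sigma>" "\<sigma> \<noteq> {}"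
    by simp_all
  have vtx: "{v} \<in> L" if "v \<in> \<sigma>" for v
    using \<sigma>L that by (metis empty_iff empty_subsetI insert_iff insert_subset)
  have pos: "0 < \<xi> {\<phi> v}" if "v \<in> \<sigma>" for v
    using wK(1)[OF K[OF vtx[OF that]]] by simp
  obtain us where us: "set us = \<phi> ` \<sigma>" "sorted_wrt (\<lambda>u v. \<xi> {u} dvd \<xi> {v}) us"
    and eq: "\<xi> (\<phi> ` \<sigma>) = (case t of Ascending \<Rightarrow> \<xi> {last us} | Descending \<Rightarrow> \<xi> {hd us})"
    using \<xi> K[OF \<sigma>] unfolding divisible_weight_def by blast
  txt \<open>Since the vertex weights of \<open>\<phi> ` \<sigma>\<close> form a divisibility chain, sorting by size sorts by divisibility.\<close>
  define vs where "vs = sort_key (\<lambda>v. \<xi> {\<phi> v}) (sorted_list_of_set \<sigma>)"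
  have vs: "set vs = \<sigma>" "distinct vs" "vs \<noteq> []"
    using fin by (simp_all add: vs_def flip: set_empty)
  \<comment> \<open>If the divisibility goes the other way, positivity turns it into the opposite
    inequality, and the two weights are equal.\<close>
  have dvd_of_le: "\<xi> {\<phi> u} dvd \<xi> {\<phi> v}" if "u \<in> \<sigma>" "v \<in> \<sigma>" "\<xi> {\<phi> u} \<le> \<xi> {\<phi> v}" for u v
    using sorted_wrt_comparable[OF us(2), of "\<phi> u" "\<phi> v"] us(1) that pos
    by (auto dest: dvd_imp_le)
  have "sorted (map (\<lambda>v. \<xi> {\<phi> v}) vs)"
    by (simp add: vs_def)
  then have srt: "sorted_wrt (\<lambda>u v. \<xi> {\<phi> u} dvd \<xi> {\<phi> v}) vs"
    unfolding sorted_wrt_map using vs(1) dvd_of_le by (auto intro: sorted_wrt_mono_rel[rotated])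
  \<comment> \<open>The last entries of \<open>us\<close> and \<open>vs\<close> need not correspond
    under \<phi>. Each carries a weight that every vertex weight divides, so antisymmetry identifies
    the two values.\<close>
  have "\<xi> {last us} = \<xi> {\<phi> (last vs)}"
  proof (rule dvd_antisym)
    have "us \<noteq> []" using us(1) fin by auto
    then obtain v where "v \<in> set vs" "last us = \<phi> v"
      using us(1) vs(1) last_in_set[of us] by auto
    then show "\<xi> {last us} dvd \<xi> {\<phi> (last vs)}"
      using sorted_wrt_last[OF srt] by simp
    show "\<xi> {\<phi> (last vs)} dvd \<xi> {last us}"
      using sorted_wrt_last[OF us(2)] us(1) vs last_in_set[of vs] by simp
  qed
  moreover have "\<xi> {hd us} = \<xi> {\<phi> (hd vs)}"
  proof (rule dvd_antisym)
    have "us \<noteq> []" using us(1) fin by auto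
    then obtain v where "v \<in> set vs" "hd us = \<phi> v"
      using us(1) vs(1) hd_in_set[of us] by auto
    then show "\<xi> {\<phi> (hd vs)} dvd \<xi> {hd us}"
      using sorted_wrt_hd[OF srt] by simp
    show "\<xi> {hd us} dvd \<xi> {\<phi> (hd vs)}"
      using sorted_wrt_hd[OF us(2)] us(1) vs hd_in_set[of vs] by simp
  qed
  moreover have "last vs \<in> \<sigma>" "hd vs \<in> \<sigma>"
    using vs by auto
  ultimately have val: "?\<eta> \<sigma> = (case t of Ascending \<Rightarrow> ?\<eta> {last vs} | Descending \<Rightarrow> ?\<eta> {hd vs})"
    using eq \<sigma> vtx by (cases t) auto
  have "sorted_wrt (\<lambda>u v. ?\<eta> {u} dvd ?\<eta> {v}) vs"
    using srt vtx vs(1) by (auto intro: sorted_wrt_mono_rel[rotated])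
  with vs val show "\<exists>vs. set vs = \<sigma> \<and> distinct vs \<and> sorted_wrt (\<lambda>u v. ?\<eta> {u} dvd ?\<eta> {v}) vs \<and>
      ?\<eta> \<sigma> = (case t of Ascending \<Rightarrow> ?\<eta> {last vs} | Descending \<Rightarrow> ?\<eta> {hd vs})"
    by blast
qed


section \<open>The prism operator\<close>

text \<open>The \<open>i\<close>-th simplex of the prism over \<open>\<Delta>\<^sup>n\<close> has the vertices
  \<open>(v\<^sub>0,0), \<dots>, (v\<^sub>i,0), (v\<^sub>i,1), \<dots>, (v\<^sub>n,1)\<close>: its point with barycentric coordinates \<open>x\<close> projects
  to \<^term>\<open>simplical_degen i x\<close> in \<open>\<Delta>\<^sup>n\<close> and to \<^term>\<open>height (Suc n) (Suc i) x\<close> in \<open>[0,1]\<close>.\<close>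

definition degen :: "nat \<Rightarrow> nat \<Rightarrow> nat" where
  "degen i k = (if k \<le> i then k else k - 1)"

text \<open>The affine extension of the vertex map \<open>degen i\<close>, which identifies the
  vertices \<open>i\<close> and \<open>Suc i\<close>.\<close>

definition simplical_degen :: "nat \<Rightarrow> (nat \<Rightarrow> real) \<Rightarrow> nat \<Rightarrow> real" where
  "simplical_degen i x = (\<lambda>k. if k < i then x k else if k = i then x i + x (Suc i) else x (Suc k))"

text \<open>The affine function with value 1 at the vertices from \<open>i\<close> to
  \<open>n\<close> and 0 at the earlier ones.\<close>

definition height :: "nat \<Rightarrow> nat \<Rightarrow> (nat \<Rightarrow> real) \<Rightarrow> real" where
  "height n i x = (\<Sum>k\<in>{i..n}. x k)"

text \<open>The \<open>j\<close>-th level is the common facet of the prism simplices \<open>j - 1\<close> and \<open>j\<close>; level \<open>0\<close> is the top of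
  the prism and level \<open>n + 1\<close> its bottom.\<close>

definition level :: "nat \<Rightarrow> ('a \<times> real \<Rightarrow> 'b) \<Rightarrow> nat \<Rightarrow> 'a wsimplex \<Rightarrow> 'b wsimplex" where
  "level n H i = (\<lambda>(\<xi>, \<theta>). (\<xi>, \<lambda>x\<in>standard_simplex n. H (\<theta> x, height n i x)))"

definition prism_simplex :: "nat \<Rightarrow> ('a \<times> real \<Rightarrow> 'b) \<Rightarrow> nat \<Rightarrow> 'a wsimplex \<Rightarrow> 'b wsimplex" where
  "prism_simplex n H i = (\<lambda>(\<xi>, \<theta>).
     (\<lambda>\<sigma>\<in>std_complex (Suc n). \<xi> (degen i ` \<sigma>),
      \<lambda>x\<in>standard_simplex (Suc n). H (\<theta> (simplical_degen i x), height (Suc n) (Suc i) x)))"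

text \<open>The homotopy is built in, so the operator lands directly in chains of the target and no
  chains of the product with the interval appear.\<close>

definition prism ::
  "nat \<Rightarrow> ('a \<times> real \<Rightarrow> 'b) \<Rightarrow> ('a wsimplex \<Rightarrow>\<^sub>0 int) \<Rightarrow> ('b wsimplex \<Rightarrow>\<^sub>0 int)" where
  "prism n H = frag_extend (\<lambda>s. \<Sum>i\<le>n. frag_cmul ((-1) ^ i) (frag_of (prism_simplex n H i s)))"

lemma degen_std: "i \<le> n \<Longrightarrow> \<sigma> \<in> std_complex (Suc n) \<Longrightarrow> degen i ` \<sigma> \<in> std_complex n"
  by (fastforce simp: std_complex_def degen_def)

lemma sum_simplical_degen:
  assumes "i \<le> n"
  shows "(\<Sum>k\<le>n. simplical_degen i x k) = (\<Sum>k\<le>Suc n. x k)"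
  using assms
proof (induction n)
  case (Suc n)
  show ?case
  proof (cases "i = Suc n")
    \<comment> \<open>The induction hypothesis needs \<open>i \<le> n\<close>, so the top index is
      treated directly: the earlier coordinates are unchanged and the last two merge.\<close>
    case True
    have "(\<Sum>k\<le>n. simplical_degen i x k) = (\<Sum>k\<le>n. x k)"
      by (rule sum.cong) (auto simp: simplical_degen_def True)
    then show ?thesis by (simp add: simplical_degen_def True)
  next
    case False
    then have "simplical_degen i x (Suc n) = x (Suc (Suc n))"
      using Suc.prems by (simp add: simplical_degen_def)
    with False Suc show ?thesis by simp
  qed
qed (simp add: simplical_degen_def)

lemma simplical_degen_in_standard_simplex:
  assumes "i \<le> n" "x \<in> standard_simplex (Suc n)"
  shows "simplical_degen i x \<in> standard_simplex n"
  unfolding geo_simplex_std[symmetric] geo_simplex_def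
  using assms sum_simplical_degen[OF assms(1), of x]
  by (auto simp: simplical_degen_def standard_simplex_def)

text \<open>Nonnegativity excludes cancellation in the merged coordinate. This lets the pulled back
  weight at a point be read off at its projection.\<close>

lemma support_simplical_degen:
  assumes "\<And>k. 0 \<le> x k"
  shows "{k. simplical_degen i x k \<noteq> 0} = degen i ` {k. x k \<noteq> 0}"
proof -
  have "x i + x (Suc i) \<noteq> 0 \<longleftrightarrow> x i \<noteq> 0 \<or> x (Suc i) \<noteq> 0"
    using assms[of i] assms[of "Suc i"] by linarith
  then have "k \<in> {k. simplical_degen i x k \<noteq> 0} \<longleftrightarrow>
      (\<exists>j\<in>(if k < i then {k} else if k = i then {i, Suc i} else {Suc k}). x j \<noteq> 0)" for k
    by (auto simp: simplical_degen_def)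
  moreover have "(if k < i then {k} else if k = i then {i, Suc i} else {Suc k}) = {j. degen i j = k}" for k
    by (auto simp: degen_def)
  ultimately have "k \<in> {k. simplical_degen i x k \<noteq> 0} \<longleftrightarrow> (\<exists>j. degen i j = k \<and> x j \<noteq> 0)" for k
    by simp
  then show ?thesis by (auto 0 3)
qed

lemma height_in_01:
  assumes "x \<in> standard_simplex n"
  shows "height n i x \<in> {0..1}"
proof -
  have "height n i x \<le> (\<Sum>k\<le>n. x k)"
    unfolding height_def by (rule sum_mono2) (auto simp: standard_simplex_nonneg[OF assms])
  then show ?thesis
    using assms by (auto simp: height_def standard_simplex_def intro: sum_nonneg)
qed

lemma continuous_map_simplical_degen:
  assumes "i \<le> n"
  shows "continuous_map (subtopology (powertop_real UNIV) (standard_simplex (Suc n)))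
           (subtopology (powertop_real UNIV) (standard_simplex n)) (simplical_degen i)"
proof -
  have "continuous_map (powertop_real UNIV) euclideanreal (\<lambda>x. simplical_degen i x k)" for k
    unfolding simplical_degen_def
    by (auto intro!: continuous_map_product_projection continuous_map_add)
  then show ?thesis
    using simplical_degen_in_standard_simplex[OF assms]
    by (auto simp: continuous_map_in_subtopology continuous_map_componentwise
        intro: continuous_map_from_subtopology)
qed

lemma continuous_map_height:
  "continuous_map (subtopology (powertop_real UNIV) (standard_simplex n))
     (top_of_set {0..1}) (height n i)"
proof -
  have "continuous_map (powertop_real UNIV) euclideanreal (height n i)"
    unfolding height_def
    by (intro continuous_map_sum continuous_map_product_projection) auto
  then show ?thesis
    using height_in_01 by (auto simp: continuous_map_in_subtopology intro: continuous_map_from_subtopology)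
qed

text \<open>At a point \<open>x\<close> the homotopy is compared with the weight of the projected
  point of \<open>X\<close>, and \<theta> compares that with \<xi> on the support of the projection.
  This support is the image under \<open>degen i\<close> of the support of \<open>x\<close>, where
  the pulled back weight is evaluated.\<close>

lemma prism_simplex_in:
  assumes s: "(\<xi>, \<theta>) \<in> wsimplices t n X l"
    and H: "W_continuous t (prod_topology X (top_of_set {0..1::real})) (\<lambda>(x, s). l x) X' l' H"
    and i: "i \<le> n"
  shows "prism_simplex n H i (\<xi>, \<theta>) \<in> wsimplices t (Suc n) X' l'"
proof -
  let ?S = "subtopology (powertop_real UNIV) (standard_simplex (Suc n))"
  let ?h = "\<lambda>x. (\<theta> (simplical_degen i x), height (Suc n) (Suc i) x)"
  have \<xi>: "divisible_weight t (std_complex n) \<xi>"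
    and \<theta>: "continuous_map (subtopology (powertop_real UNIV) (standard_simplex n)) X \<theta>"
    and dv: "\<And>x. x \<in> standard_simplex n \<Longrightarrow> wdvd t (l (\<theta> x)) (\<xi> {i. x i \<noteq> 0})"
    using s by (auto simp: wsimplices_iff singular_simplex_def)
  have h: "continuous_map ?S (prod_topology X (top_of_set {0..1})) ?h"
    using continuous_map_compose[OF continuous_map_simplical_degen[OF i] \<theta>] continuous_map_height
    by (auto simp: continuous_map_pairwise o_def)
  then have Hh: "continuous_map ?S X' (\<lambda>x. H (?h x))"
    using H continuous_map_compose[OF h, of X' H] by (simp add: W_continuous_def o_def)
  have "wdvd t (l' (H (?h x))) (\<xi> (degen i ` {k. x k \<noteq> 0}))" if x: "x \<in> standard_simplex (Suc n)" for x
  proof -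
    have "?h x \<in> topspace (prod_topology X (top_of_set {0..1}))"
      using continuous_map_image_subset_topspace[OF h] x by auto
    then have "wdvd t (l' (H (?h x))) (case ?h x of (y, s) \<Rightarrow> l y)"
      using H unfolding W_continuous_def by blast
    then have "wdvd t (l' (H (?h x))) (l (\<theta> (simplical_degen i x)))"
      by simp
    then show ?thesis
      by (rule wdvd_trans) (use dv[OF simplical_degen_in_standard_simplex[OF i x]]
        support_simplical_degen[OF standard_simplex_nonneg[OF x], of i] in simp)
  qed
  moreover have "continuous_map ?S X' (\<lambda>x\<in>standard_simplex (Suc n). H (?h x))"
    by (rule continuous_map_eq[OF Hh]) simp
  ultimately show ?thesis
    using divisible_weight_pullback[OF is_complex_std degen_std[OF i] \<xi>] support_std_complex
    by (auto simp: prism_simplex_def wsimplices_iff singular_simplex_def)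
qed

section \<open>Facets of the prism simplices\<close>

lemma image_degen_atMost: "i \<le> n \<Longrightarrow> degen i ` {..Suc n} = {..n}"
proof (intro equalityI subsetI)
  fix k assume "i \<le> n" "k \<in> {..n}"
  then have "k = degen i (if k \<le> i then k else Suc k)" "(if k \<le> i then k else Suc k) \<in> {..Suc n}"
    by (auto simp: degen_def)
  then show "k \<in> degen i ` {..Suc n}"
    by (rule image_eqI)
qed (auto simp: degen_def)

text \<open>The simplicial identities on vertices. In the middle case, \<open>j = i\<close> or
  \<open>j = Suc i\<close>, the facet projects isomorphically onto the whole base simplex.\<close>

lemma degen_skip:
  "degen i (skip j k) = (if j < i then skip j (degen (i - 1) k)
     else if j \<le> Suc i then k else skip (j - 1) (degen i k))"
  by (auto simp: degen_def skip_def)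

text \<open>The affine counterparts of \<open>degen_skip\<close> are split by case, with indices
  shifted by \<open>Suc\<close> in place of truncated subtraction.\<close>

lemma simplical_degen_face_less:
  "j \<le> i \<Longrightarrow> simplical_degen (Suc i) (simplical_face j x) = simplical_face j (simplical_degen i x)"
proof (rule ext)
  fix k assume "j \<le> i"
  then show "simplical_degen (Suc i) (simplical_face j x) k = simplical_face j (simplical_degen i x) k"
    by (cases k) (simp_all add: simplical_degen_def simplical_face_def)
qed

lemma simplical_degen_face_id:
  "j = i \<or> j = Suc i \<Longrightarrow> simplical_degen i (simplical_face j x) = x"
  by (rule ext) (auto simp: simplical_degen_def simplical_face_def)

lemma simplical_degen_face_greater:
  "i < j \<Longrightarrow> simplical_degen i (simplical_face (Suc j) x) = simplical_face j (simplical_degen i x)"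
proof (rule ext)
  fix k assume "i < j"
  then show "simplical_degen i (simplical_face (Suc j) x) k = simplical_face j (simplical_degen i x) k"
    by (cases k) (simp_all add: simplical_degen_def simplical_face_def)
qed

text \<open>The face map inserts a zero at position \<open>j\<close> and shifts the later
  coordinates up. The starting index drops by one exactly when the inserted zero lies below
  it.\<close>

lemma height_simplical_face:
  assumes "j \<le> Suc n"
  shows "height (Suc n) i (simplical_face j x) = (if j < i then height n (i - 1) x else height n i x)"
proof -
  have "height (Suc n) i (simplical_face j x) = (\<Sum>k\<in>{i..Suc n} - {j}. simplical_face j x k)"
    unfolding height_def by (rule sum.mono_neutral_right) (auto simp: simplical_face_def)
  also have "{i..Suc n} - {j} = skip j ` (if j < i then {i - 1..n} else {i..n})"
  proof (intro equalityI subsetI)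
    fix k assume k: "k \<in> {i..Suc n} - {j}"
    then have "k = skip j (if k < j then k else k - 1)"
      by (auto simp: skip_def)
    then show "k \<in> skip j ` (if j < i then {i - 1..n} else {i..n})"
      by (rule image_eqI) (use k assms in auto)
  qed (use assms in \<open>auto simp: skip_def split: if_splits\<close>)
  also have "(\<Sum>k\<in>\<dots>. simplical_face j x k) =
      (\<Sum>k\<in>(if j < i then {i - 1..n} else {i..n}). simplical_face j x (skip j k))"
    by (rule sum.reindex[OF inj_on_subset[OF skip_inj subset_UNIV], unfolded o_def])
  also have "\<dots> = (\<Sum>k\<in>(if j < i then {i - 1..n} else {i..n}). x k)"
    by (rule sum.cong) (auto simp: simplical_face_def skip_def)
  finally show ?thesis
    by (simp add: height_def)
qed

text \<open>Such a facet projects identically to the base, so pulling back returns \<xi> on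
  simplices, and extensionality makes this an equality of functions. As the result depends on
  \<open>j\<close> alone, neighbouring prism simplices share their common facet, weight
  included.\<close>

lemma wface_prism_simplex_level:
  assumes "\<xi> \<in> extensional (std_complex n)" "i \<le> n" "j = i \<or> j = Suc i"
  shows "wface (Suc n) j (prism_simplex n H i (\<xi>, \<theta>)) = level n H j (\<xi>, \<theta>)"
proof -
  have "degen i ` skip j ` \<sigma> = \<sigma>" for \<sigma>
    using assms(3) by (auto simp: image_image degen_skip)
  then have "(\<lambda>\<sigma>\<in>std_complex n. (\<lambda>\<sigma>\<in>std_complex (Suc n). \<xi> (degen i ` \<sigma>)) (skip j ` \<sigma>)) = \<xi>"
    using assms(1) skip_std by (intro extensionalityI[of _ "std_complex n"]) auto
  moreover have "simplical_degen i (simplical_face j x) = x"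
    and "height (Suc n) (Suc i) (simplical_face j x) = height n j x" for x
    using assms by (auto simp: simplical_degen_face_id simplical_degen_face_less simplical_degen_face_greater height_simplical_face)
  ultimately show ?thesis
    using assms simplical_face_in_standard_simplex[of "Suc n" j]
    by (auto simp: wface_def prism_simplex_def level_def singular_face_def intro!: restrict_ext)
qed

text \<open>Removing a vertex below the doubled one lowers the index of the doubled vertex by
  one.\<close>

lemma wface_prism_simplex_less:
  assumes "j \<le> i" "i \<le> n"
  shows "wface (Suc (Suc n)) j (prism_simplex (Suc n) H (Suc i) (\<xi>, \<theta>)) =
         prism_simplex n H i (wface (Suc n) j (\<xi>, \<theta>))"
proof -
  have "degen (Suc i) ` skip j ` \<sigma> = skip j ` degen i ` \<sigma>" for \<sigma>
    using assms(1) by (auto simp: image_image degen_skip)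
  moreover have "simplical_degen (Suc i) (simplical_face j x) = simplical_face j (simplical_degen i x)"
    and "height (Suc (Suc n)) (Suc (Suc i)) (simplical_face j x) = height (Suc n) (Suc i) x" for x :: "nat \<Rightarrow> real"
    using assms by (auto simp: simplical_degen_face_id simplical_degen_face_less simplical_degen_face_greater height_simplical_face)
  ultimately show ?thesis
    using assms simplical_face_in_standard_simplex[of "Suc (Suc n)" j]
      simplical_degen_in_standard_simplex[of i n] skip_std degen_std[of i n]
    by (auto simp: wface_def prism_simplex_def singular_face_def intro!: restrict_ext)
qed

text \<open>A vertex above the doubled one has its index raised by the doubling, hence
  \<open>Suc j\<close> on the left; removing it leaves \<open>i\<close> in place.\<close>

lemma wface_prism_simplex_greater:
  assumes "i < j" "j \<le> Suc n"
  shows "wface (Suc (Suc n)) (Suc j) (prism_simplex (Suc n) H i (\<xi>, \<theta>)) =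
         prism_simplex n H i (wface (Suc n) j (\<xi>, \<theta>))"
proof -
  have "degen i ` skip (Suc j) ` \<sigma> = skip j ` degen i ` \<sigma>" for \<sigma>
    using assms(1) by (auto simp: image_image degen_skip)
  moreover have "simplical_degen i (simplical_face (Suc j) x) = simplical_face j (simplical_degen i x)"
    and "height (Suc (Suc n)) (Suc i) (simplical_face (Suc j) x) = height (Suc n) (Suc i) x" for x :: "nat \<Rightarrow> real"
    using assms by (auto simp: simplical_degen_face_id simplical_degen_face_less simplical_degen_face_greater height_simplical_face)
  ultimately show ?thesis
    using assms simplical_face_in_standard_simplex[of "Suc (Suc n)" "Suc j"]
      simplical_degen_in_standard_simplex[of i n] skip_std degen_std[of i n]
    by (auto simp: wface_def prism_simplex_def singular_face_def intro!: restrict_ext)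
qed

section \<open>Boundary coefficients of the prism simplices\<close>

lemma wcoeff_prism_simplex_level:
  assumes "divisible_weight t (std_complex n) \<xi>" "i \<le> n" "j = i \<or> j = Suc i"
  shows "wcoeff t (Suc n) j (fst (prism_simplex n H i (\<xi>, \<theta>))) = 1"
proof -
  have "degen i ` ({..Suc n} - {j}) = {..n}"
  proof (intro equalityI subsetI)
    fix k assume "k \<in> {..n}"
    then have "k = degen i (skip j k)" "skip j k \<in> {..Suc n} - {j}"
      using assms(3) by (auto simp: degen_def skip_def)
    then show "k \<in> degen i ` ({..Suc n} - {j})"
      by (rule image_eqI)
  qed (use assms in \<open>auto simp: degen_def\<close>)
  moreover have "{..Suc n} \<in> std_complex (Suc n)" "{..Suc n} - {j} \<in> std_complex (Suc n)"
    by (cases j) (auto simp: std_complex_def)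
  \<comment> \<open>Numerator and denominator are both this weight; positivity makes the quotient 1
    rather than the default value 0.\<close>
  moreover have "0 < \<xi> {..n}"
    using assms(1) by (auto simp: divisible_weight_def is_weight_def std_complex_def)
  ultimately show ?thesis
    using assms(2) by (cases t) (simp_all add: wcoeff_def prism_simplex_def image_degen_atMost)
qed

text \<open>The prism simplex projects onto the whole base simplex and its facet onto the facet
  opposite \<open>j\<close>, so both weights in the quotient are those of the base.\<close>

lemma wcoeff_prism_simplex_less:
  assumes "j \<le> i" "i \<le> n"
  shows "wcoeff t (Suc (Suc n)) j (fst (prism_simplex (Suc n) H (Suc i) (\<xi>, \<theta>))) = wcoeff t (Suc n) j \<xi>"
proof -
  have "degen (Suc i) ` ({..Suc (Suc n)} - {j}) = {..Suc n} - {j}"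
  proof (intro equalityI subsetI)
    fix k assume "k \<in> {..Suc n} - {j}"
    then have "k = degen (Suc i) (if k \<le> i then k else Suc k)"
      "(if k \<le> i then k else Suc k) \<in> {..Suc (Suc n)} - {j}"
      using assms by (auto simp: degen_def)
    then show "k \<in> degen (Suc i) ` ({..Suc (Suc n)} - {j})"
      by (rule image_eqI)
  qed (use assms in \<open>auto simp: degen_def\<close>)
  moreover have "{..Suc (Suc n)} \<in> std_complex (Suc (Suc n))" "{..Suc (Suc n)} - {j} \<in> std_complex (Suc (Suc n))"
    by (cases j) (auto simp: std_complex_def)
  ultimately show ?thesis
    using assms by (cases t) (simp_all add: wcoeff_def prism_simplex_def image_degen_atMost)
qed

lemma wcoeff_prism_simplex_greater:
  assumes "i < j" "j \<le> Suc n"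
  shows "wcoeff t (Suc (Suc n)) (Suc j) (fst (prism_simplex (Suc n) H i (\<xi>, \<theta>))) = wcoeff t (Suc n) j \<xi>"
proof -
  have "degen i ` ({..Suc (Suc n)} - {Suc j}) = {..Suc n} - {j}"
  proof (intro equalityI subsetI)
    fix k assume "k \<in> {..Suc n} - {j}"
    then have "k = degen i (if k \<le> i then k else Suc k)"
      "(if k \<le> i then k else Suc k) \<in> {..Suc (Suc n)} - {Suc j}"
      using assms by (auto simp: degen_def)
    then show "k \<in> degen i ` ({..Suc (Suc n)} - {Suc j})"
      by (rule image_eqI)
  qed (use assms in \<open>auto simp: degen_def\<close>)
  moreover have "{..Suc (Suc n)} \<in> std_complex (Suc (Suc n))" "{..Suc (Suc n)} - {Suc j} \<in> std_complex (Suc (Suc n))"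
    by (auto simp: std_complex_def)
  ultimately show ?thesis
    using assms by (cases t) (simp_all add: wcoeff_def prism_simplex_def image_degen_atMost)
qed

section \<open>The prism identity\<close>

lemma level_0:
  assumes "singular_simplex n X \<theta>" "\<And>x. x \<in> topspace X \<Longrightarrow> H (x, 1) = g x"
  shows "level n H 0 (\<xi>, \<theta>) = (\<xi>, simplex_map n g \<theta>)"
proof -
  have "\<theta> x \<in> topspace X" if "x \<in> standard_simplex n" for x
    using assms(1) that continuous_map_image_subset_topspace by (fastforce simp: singular_simplex_def)
  \<comment> \<open>The height from index 0 is the sum of all barycentric coordinates.\<close>
  moreover have "height n 0 x = 1" if "x \<in> standard_simplex n" for x
    using that by (simp add: height_def standard_simplex_def atMost_atLeast0)
  ultimately show ?thesis
    by (auto simp: level_def simplex_map_def assms(2) intro!: restrict_ext)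
qed

text \<open>The height from \<open>Suc n\<close> is an empty sum, so this level lies at height
  0.\<close>

lemma level_Suc:
  assumes "singular_simplex n X \<theta>" "\<And>x. x \<in> topspace X \<Longrightarrow> H (x, 0) = f x"
  shows "level n H (Suc n) (\<xi>, \<theta>) = (\<xi>, simplex_map n f \<theta>)"
proof -
  have "\<theta> x \<in> topspace X" if "x \<in> standard_simplex n" for x
    using assms(1) that continuous_map_image_subset_topspace by (fastforce simp: singular_simplex_def)
  then show ?thesis
    by (auto simp: level_def simplex_map_def height_def assms(2) intro!: restrict_ext)
qed

text \<open>Sorts the facets into the levels and those lying over the facets of the base. The shifts
  match \<open>wface_prism_simplex_less\<close> and \<open>wface_prism_simplex_greater\<close>, and
  make the last two index sets a partition of the pairs with \<open>i < n\<close> and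
  \<open>j \<le> n\<close>.\<close>

lemma sum_prism_faces:
  fixes A :: "nat \<Rightarrow> nat \<Rightarrow> 'g :: ab_group_add"
  shows "(\<Sum>i\<le>n. \<Sum>j\<le>Suc n. A i j) =
    (\<Sum>i\<le>n. A i i + A i (Suc i)) + (\<Sum>(i,j)\<in>{(i,j). j \<le> i \<and> i < n}. A (Suc i) j)
      + (\<Sum>(i,j)\<in>{(i,j). i < j \<and> j \<le> n}. A i (Suc j))"
proof -
  define D where "D = {(i,j). i \<le> n \<and> (j = i \<or> j = Suc i)}"
  define L where "L = {(i,j). j < i \<and> i \<le> n}"
  define U where "U = {(i,j). Suc i < j \<and> j \<le> Suc n}"
  have eq: "{..n} \<times> {..Suc n} = D \<union> L \<union> U"
    by (auto simp: D_def L_def U_def)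
  moreover have "finite ({..n} \<times> {..Suc n})"
    by simp
  ultimately have fin: "finite D" "finite L" "finite U"
    by simp_all
  have "(\<Sum>i\<le>n. \<Sum>j\<le>Suc n. A i j) = (\<Sum>(i,j)\<in>{..n} \<times> {..Suc n}. A i j)"
    by (rule sum.cartesian_product)
  also have "\<dots> = (\<Sum>(i,j)\<in>D. A i j) + (\<Sum>(i,j)\<in>L. A i j) + (\<Sum>(i,j)\<in>U. A i j)"
  proof -
    have "(D \<union> L) \<inter> U = {}" "D \<inter> L = {}"
      by (auto simp: D_def L_def U_def)
    then show ?thesis
      unfolding eq using fin by (simp add: sum.union_disjoint)
  qed
  also have "(\<Sum>(i,j)\<in>D. A i j) = (\<Sum>i\<le>n. A i i + A i (Suc i))"
  proof -
    have "D = Sigma {..n} (\<lambda>i. {i, Suc i})"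
      by (auto simp: D_def)
    then have "(\<Sum>(i,j)\<in>D. A i j) = (\<Sum>i\<le>n. \<Sum>j\<in>{i, Suc i}. A i j)"
      using sum.Sigma[of "{..n}" "\<lambda>i. {i, Suc i}" A] by simp
    then show ?thesis by simp
  qed
  also have "(\<Sum>(i,j)\<in>L. A i j) = (\<Sum>(i,j)\<in>{(i,j). j \<le> i \<and> i < n}. A (Suc i) j)"
    by (rule sum.reindex_bij_witness[of _ "\<lambda>(i,j). (Suc i, j)" "\<lambda>(i,j). (i - 1, j)"])
      (auto simp: L_def)
  also have "(\<Sum>(i,j)\<in>U. A i j) = (\<Sum>(i,j)\<in>{(i,j). i < j \<and> j \<le> n}. A i (Suc j))"
    by (rule sum.reindex_bij_witness[of _ "\<lambda>(i,j). (i, Suc j)" "\<lambda>(i,j). (i, j - 1)"])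
      (auto simp: U_def)
  finally show ?thesis .
qed

text \<open>The truncated \<open>n - 1\<close> is harmless at \<open>n = 0\<close>, where the boundary vanishes.\<close>

lemma prism_boundary:
  assumes c: "c \<in> carrier (wchain_group t n X l)"
    and H: "\<And>x. x \<in> topspace X \<Longrightarrow> H (x, 0) = f x \<and> H (x, 1) = g x"
  shows "wboundary t (Suc n) (prism n H c) =
    wchain_map n g c - wchain_map n f c - prism (n - 1) H (wboundary t n c)"
proof -
  have "Poly_Mapping.keys c \<subseteq> wsimplices t n X l"
    using c by (simp add: wchain_group_def)
  then show ?thesis
  proof (induction rule: frag_induction)
    case zero
    show ?case by (simp add: wboundary_def prism_def wchain_map_def)
  next
    case (diff a b)
    then show ?case
      by (simp add: wboundary_def prism_def wchain_map_def frag_extend_diff split: if_splits)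
  next
    case (one s)
    obtain \<xi> \<theta> where s: "s = (\<xi>, \<theta>)" by force
    have \<xi>: "divisible_weight t (std_complex n) \<xi>" "\<xi> \<in> extensional (std_complex n)"
      and \<theta>: "singular_simplex n X \<theta>"
      using one s by (auto simp: wsimplices_iff)
    define A where "A i j = frag_cmul ((-1) ^ (i + j) * int (wcoeff t (Suc n) j (fst (prism_simplex n H i s))))
      (frag_of (wface (Suc n) j (prism_simplex n H i s)))" for i j
    define P where "P = {(i,j). j \<le> i \<and> i < n}"
    define Q where "Q = {(i,j). i < j \<and> j \<le> n}"
    have "wboundary t (Suc n) (prism n H (frag_of s)) = (\<Sum>i\<le>n. \<Sum>j\<le>Suc n. A i j)"
      unfolding wboundary_def prism_def
      by (simp only: nat.simps if_False frag_extend_of frag_extend_sum[OF finite_atMost]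
          frag_extend_cmul frag_cmul_sum comp_def frag_cmul_cmul A_def power_add mult.assoc)
    also have "\<dots> = (\<Sum>i\<le>n. A i i + A i (Suc i)) + ((\<Sum>(i,j)\<in>P. A (Suc i) j) + (\<Sum>(i,j)\<in>Q. A i (Suc j)))"
      unfolding P_def Q_def by (simp only: sum_prism_faces add.assoc)
    also have "(\<Sum>i\<le>n. A i i + A i (Suc i)) = wchain_map n g (frag_of s) - wchain_map n f (frag_of s)"
    proof -
      \<comment> \<open>The two level facets have coefficient 1 and opposite signs, so their sum
        over \<open>i\<close> telescopes to the two ends of the prism.\<close>
      have "A i i + A i (Suc i) = frag_of (level n H i s) - frag_of (level n H (Suc i) s)" if "i \<le> n" for i
        using that \<xi> by (simp add: A_def s wface_prism_simplex_level wcoeff_prism_simplex_level)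
      then have "(\<Sum>i\<le>n. A i i + A i (Suc i)) =
          (\<Sum>i<Suc n. frag_of (level n H i s) - frag_of (level n H (Suc i) s))"
        unfolding lessThan_Suc_atMost by (intro sum.cong) auto
      also have "\<dots> = frag_of (level n H 0 s) - frag_of (level n H (Suc n) s)"
        by (rule sum_lessThan_telescope')
      finally show ?thesis
        using level_0[OF \<theta>, of H g] level_Suc[OF \<theta>, of H f] H by (simp add: s wchain_map_def)
    qed
    also have "(\<Sum>(i,j)\<in>P. A (Suc i) j) + (\<Sum>(i,j)\<in>Q. A i (Suc j)) =
        - prism (n - 1) H (wboundary t n (frag_of s))"
    proof (cases n)
      case 0
      then have "P = {}" "Q = {}"
        by (auto simp: P_def Q_def)
      then show ?thesis
        by (simp add: wboundary_def prism_def 0)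
    next
      case (Suc m)
      \<comment> \<open>The contribution of prism simplex \<open>i\<close> over facet
        \<open>j\<close> of the base, as it occurs in the prism of the boundary.\<close>
      define B where "B i j = frag_cmul ((-1) ^ (i + j) * int (wcoeff t n j \<xi>))
        (frag_of (prism_simplex m H i (wface n j s)))" for i j
      have PQ: "{..m} \<times> {..n} = P \<union> Q" "P \<inter> Q = {}"
        by (auto simp: P_def Q_def Suc)
      moreover have "finite ({..m} \<times> {..n})"
        by simp
      ultimately have fin: "finite P" "finite Q"
        by simp_all
      \<comment> \<open>The simplex and the coefficient agree; the one extra \<open>Suc\<close> in
        the exponent gives the minus sign.\<close>
      have "A (Suc i) j = - B i j" if "j \<le> i" "i < n" for i j
        using that wface_prism_simplex_less[of j i m H \<xi> \<theta>] wcoeff_prism_simplex_less[of j i m t H \<xi> \<theta>]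
        by (simp add: A_def B_def Suc s)
      then have "(\<Sum>(i,j)\<in>P. A (Suc i) j) = - (\<Sum>(i,j)\<in>P. B i j)"
        by (auto simp: P_def simp flip: sum_negf intro!: sum.cong)
      moreover have "A i (Suc j) = - B i j" if "i < j" "j \<le> n" for i j
        using that wface_prism_simplex_greater[of i j m H \<xi> \<theta>] wcoeff_prism_simplex_greater[of i j m t H \<xi> \<theta>]
        by (simp add: A_def B_def Suc s)
      then have "(\<Sum>(i,j)\<in>Q. A i (Suc j)) = - (\<Sum>(i,j)\<in>Q. B i j)"
        by (auto simp: Q_def simp flip: sum_negf intro!: sum.cong)
      moreover have "prism m H (wboundary t n (frag_of s)) = (\<Sum>j\<le>n. \<Sum>i\<le>m. B i j)"
        unfolding wboundary_def prism_def Suc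
        by (simp only: nat.simps if_False frag_extend_of frag_extend_sum[OF finite_atMost]
            frag_extend_cmul frag_cmul_sum comp_def frag_cmul_cmul B_def power_add mult_ac Suc s fst_conv)
      moreover have "(\<Sum>j\<le>n. \<Sum>i\<le>m. B i j) = (\<Sum>(i,j)\<in>P. B i j) + (\<Sum>(i,j)\<in>Q. B i j)"
      proof -
        have "(\<Sum>j\<le>n. \<Sum>i\<le>m. B i j) = (\<Sum>(i,j)\<in>P \<union> Q. B i j)"
          by (subst sum.swap) (simp add: sum.cartesian_product PQ(1))
        then show ?thesis
          using fin PQ(2) by (simp add: sum.union_disjoint)
      qed
      ultimately show ?thesis
        by (simp add: Suc)
    qed
    finally show ?case by simp
  qed
qed


section \<open>Induced maps on weighted homology\<close>

lemma frag_extend_in_free_Abelian_group: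
  assumes "c \<in> carrier (free_Abelian_group S)"
    and "\<And>s. s \<in> S \<Longrightarrow> F s \<in> carrier (free_Abelian_group T)"
  shows "frag_extend F c \<in> carrier (free_Abelian_group T)"
  using assms keys_frag_extend[of F c] unfolding carrier_free_Abelian_group_iff by blast

lemma frag_cmul_in_free_Abelian_group:
  "c \<in> carrier (free_Abelian_group S) \<Longrightarrow> frag_cmul a c \<in> carrier (free_Abelian_group S)"
  using keys_cmul[of a c] unfolding carrier_free_Abelian_group_iff by blast

lemma wboundary_in:
  assumes "c \<in> carrier (wchain_group t n X l)"
  shows "wboundary t n c \<in> carrier (wchain_group t (n - 1) X l)"
proof (cases n)
  case (Suc m)
  show ?thesis
    using assms unfolding wchain_group_def wboundary_def Suc
    by (simp only: nat.simps if_False diff_Suc_1)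
       (erule frag_extend_in_free_Abelian_group,
        intro sum_closed_free_Abelian_group frag_cmul_in_free_Abelian_group,
        simp only: frag_of_in_free_Abelian_group atMost_iff wface_in)
qed (simp add: wboundary_def wchain_group_def)

lemma wboundary_0 [simp]: "wboundary t n 0 = 0"
  by (simp add: wboundary_def)

lemma wboundary_add: "wboundary t n (a + b) = wboundary t n a + wboundary t n b"
  by (simp add: wboundary_def frag_extend_add)

lemma wboundary_minus: "wboundary t n (- a) = - wboundary t n a"
  by (simp add: wboundary_def frag_extend_minus)

lemma wchain_map_in:
  assumes "c \<in> carrier (wchain_group t n X l)" "W_continuous t X l X' l' f"
  shows "wchain_map n f c \<in> carrier (wchain_group t n X' l')"
  using assms(1) unfolding wchain_group_def wchain_map_def
  by (rule frag_extend_in_free_Abelian_group) (auto intro: wsimplex_map_in[OF _ assms(2)])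

lemma wchain_map_add: "wchain_map n f (a + b) = wchain_map n f a + wchain_map n f b"
  by (simp add: wchain_map_def frag_extend_add)

lemma prism_in:
  assumes "c \<in> carrier (wchain_group t n X l)"
    and "W_continuous t (prod_topology X (top_of_set {0..1::real})) (\<lambda>(x, s). l x) X' l' H"
  shows "prism n H c \<in> carrier (wchain_group t (Suc n) X' l')"
  using assms(1) unfolding wchain_group_def prism_def
proof (rule frag_extend_in_free_Abelian_group)
  fix s assume "s \<in> wsimplices t n X l"
  then have "prism_simplex n H i s \<in> wsimplices t (Suc n) X' l'" if "i \<le> n" for i
    using prism_simplex_in[OF _ assms(2) that] by (cases s) simp
  then show "(\<Sum>i\<le>n. frag_cmul ((-1) ^ i) (frag_of (prism_simplex n H i s)))
      \<in> carrier (free_Abelian_group (wsimplices t (Suc n) X' l'))"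
    by (intro sum_closed_free_Abelian_group frag_cmul_in_free_Abelian_group) simp
qed

text \<open>Composition with \<open>f\<close> leaves the weight of a simplex alone, so the
  coefficients on both sides agree and only the facets have to be compared. Induction over
  \<open>UNIV\<close> as generating set covers all formal chains.\<close>

lemma wboundary_wchain_map:
  "wboundary t n (wchain_map n f c) = wchain_map (n - 1) f (wboundary t n c)"
proof (cases n)
  case (Suc m)
  show ?thesis
    using subset_UNIV
  proof (induction c rule: frag_induction)
    case (one s)
    obtain \<xi> \<theta> where s: "s = (\<xi>, \<theta>)" by force
    have "singular_face n j (simplex_map n f \<theta>) = simplex_map m f (singular_face n j \<theta>)" if "j \<le> n" for j
      using that singular_face_simplex_map[of n j f \<theta>]
      by (auto simp: Suc simplex_map_def singular_face_def)
    then have "wface n j (\<xi>, simplex_map n f \<theta>) =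
        (\<lambda>(\<xi>, \<theta>). (\<xi>, simplex_map m f \<theta>)) (wface n j (\<xi>, \<theta>))" if "j \<le> n" for j
      using that by (simp add: wface_def)
    then show ?case
      by (simp add: s Suc wboundary_def wchain_map_def frag_extend_sum frag_extend_cmul split_beta
          del: sum.atMost_Suc)
  qed (simp_all add: Suc wboundary_def wchain_map_def frag_extend_diff)
qed (simp add: wboundary_def wchain_map_def)

text \<open>\<open>simplex_map n id\<close> restricts a map to the standard simplex; extensionality
  of the maps in \<open>wsimplices\<close> makes this the identity.\<close>

lemma wchain_map_id:
  assumes "c \<in> carrier (wchain_group t n X l)"
  shows "wchain_map n id c = c"
proof -
  have "wchain_map n id c = frag_extend frag_of c"
    unfolding wchain_map_def
  proof (rule frag_extend_eq)
    fix s assume "s \<in> Poly_Mapping.keys c"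
    then have "s \<in> wsimplices t n X l"
      using assms by (auto simp: wchain_group_def)
    then show "(\<lambda>(\<xi>, \<theta>). frag_of (\<xi>, simplex_map n id \<theta>)) s = frag_of s"
      by (auto simp: wsimplices_def extensional_restrict)
  qed
  then show ?thesis
    by (simp flip: frag_expansion)
qed

lemma wchain_map_compose: "wchain_map n g (wchain_map n f c) = wchain_map n (g \<circ> f) c"
  using subset_UNIV
proof (induction c rule: frag_induction)
  case (one s)
  have "simplex_map n g (simplex_map n f \<theta>) = simplex_map n (g \<circ> f) \<theta>" for \<theta>
    by (simp only: simplex_map_compose o_apply)
  then show ?case
    by (cases s rule: prod.exhaust) (simp only: wchain_map_def frag_extend_of prod.case)
qed (simp_all add: wchain_map_def frag_extend_diff)

section \<open>Cycles, boundaries and their quotient\<close>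

lemma wcycles_iff:
  "c \<in> wcycles t n X l \<longleftrightarrow> c \<in> carrier (wchain_group t n X l) \<and> wboundary t n c = 0"
  by (simp add: wcycles_def)

lemma carrier_wcycle_group [simp]: "carrier (wcycle_group t n X l) = wcycles t n X l"
  and mult_wcycle_group [simp]: "a \<otimes>\<^bsub>wcycle_group t n X l\<^esub> b = a + b"
  by (simp_all add: wcycle_group_def wchain_group_def)

lemma comm_group_wchain_group: "comm_group (wchain_group t n X l)"
  by (simp add: wchain_group_def abelian_free_Abelian_group)

lemma m_inv_wchain_group:
  "a \<in> carrier (wchain_group t n X l) \<Longrightarrow> inv\<^bsub>wchain_group t n X l\<^esub> a = - a"
  by (simp add: wchain_group_def)

lemma subgroup_wcycles: "subgroup (wcycles t n X l) (wchain_group t n X l)"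
proof -
  interpret comm_group "wchain_group t n X l"
    by (rule comm_group_wchain_group)
  show ?thesis
  proof (rule subgroupI)
    show "wcycles t n X l \<subseteq> carrier (wchain_group t n X l)"
      by (auto simp: wcycles_iff)
    show "wcycles t n X l \<noteq> {}"
      using one_closed by (auto simp: wcycles_def wchain_group_def intro!: exI[of _ 0])
    show "inv\<^bsub>wchain_group t n X l\<^esub> a \<in> wcycles t n X l" if "a \<in> wcycles t n X l" for a
      using that inv_closed[of a] by (simp add: wcycles_iff m_inv_wchain_group wboundary_minus)
    show "a \<otimes>\<^bsub>wchain_group t n X l\<^esub> b \<in> wcycles t n X l" if "a \<in> wcycles t n X l" "b \<in> wcycles t n X l" for a b
      using that m_closed[of a b] by (simp add: wcycles_iff wboundary_add wchain_group_def)
  qed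
qed

lemma wboundaries_subset: "wboundaries t n X l \<subseteq> wcycles t n X l"
proof
  fix b assume "b \<in> wboundaries t n X l"
  then obtain c where c: "c \<in> carrier (wchain_group t (Suc n) X l)" "b = wboundary t (Suc n) c"
    by (auto simp: wboundaries_def)
  \<comment> \<open>For \<open>n = 0\<close> the outer boundary is zero by definition; otherwise two
    successive boundaries cancel.\<close>
  have "wboundary t n b = 0"
    using c wboundary_wboundary by (cases n) (auto simp: wboundary_def[of t 0])
  then show "b \<in> wcycles t n X l"
    using wboundary_in[OF c(1)] c(2) by (simp add: wcycles_iff)
qed

lemma subgroup_wboundaries_chain: "subgroup (wboundaries t n X l) (wchain_group t n X l)"
proof -
  interpret S: comm_group "wchain_group t (Suc n) X l"
    by (rule comm_group_wchain_group)
  interpret comm_group "wchain_group t n X l"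
    by (rule comm_group_wchain_group)
  have sub: "wboundaries t n X l \<subseteq> carrier (wchain_group t n X l)"
    using wboundaries_subset by (force simp: wcycles_iff)
  show ?thesis
  proof (rule subgroupI[OF sub])
    show "wboundaries t n X l \<noteq> {}"
      using S.one_closed unfolding wboundaries_def by blast
    show "inv\<^bsub>wchain_group t n X l\<^esub> a \<in> wboundaries t n X l" if a: "a \<in> wboundaries t n X l" for a
    proof -
      obtain c where c: "c \<in> carrier (wchain_group t (Suc n) X l)" "a = wboundary t (Suc n) c"
        using a by (auto simp: wboundaries_def)
      then have "inv\<^bsub>wchain_group t n X l\<^esub> a = wboundary t (Suc n) (inv\<^bsub>wchain_group t (Suc n) X l\<^esub> c)"
        using a sub by (simp add: m_inv_wchain_group wboundary_minus subset_iff)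
      then show ?thesis
        using S.inv_closed[OF c(1)] by (simp add: wboundaries_def)
    qed
    show "a \<otimes>\<^bsub>wchain_group t n X l\<^esub> b \<in> wboundaries t n X l"
      if ab: "a \<in> wboundaries t n X l" "b \<in> wboundaries t n X l" for a b
    proof -
      obtain c d where c: "c \<in> carrier (wchain_group t (Suc n) X l)" "a = wboundary t (Suc n) c"
        and d: "d \<in> carrier (wchain_group t (Suc n) X l)" "b = wboundary t (Suc n) d"
        using ab by (auto simp: wboundaries_def)
      then have "a \<otimes>\<^bsub>wchain_group t n X l\<^esub> b = wboundary t (Suc n) (c \<otimes>\<^bsub>wchain_group t (Suc n) X l\<^esub> d)"
        by (simp add: wboundary_add wchain_group_def)
      then show ?thesis
        using S.m_closed[OF c(1) d(1)] by (simp add: wboundaries_def)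
    qed
  qed
qed

text \<open>Cycles form a commutative group, so normality is automatic. It opens the coset calculus
  of the locale \<open>normal\<close>.\<close>

lemma normal_wboundaries: "wboundaries t n X l \<lhd> wcycle_group t n X l"
proof -
  interpret comm_group "wchain_group t n X l"
    by (rule comm_group_wchain_group)
  have "group (wcycle_group t n X l)"
    unfolding wcycle_group_def by (rule subgroup_imp_group[OF subgroup_wcycles])
  then have "comm_group (wcycle_group t n X l)"
    by (rule group.group_comm_groupI) (simp add: add.commute)
  moreover have "subgroup (wboundaries t n X l) (wcycle_group t n X l)"
    unfolding wcycle_group_def
    by (rule subgroup_incl[OF subgroup_wboundaries_chain subgroup_wcycles wboundaries_subset])
  ultimately show ?thesis
    by (rule comm_group.subgroup_imp_normal)
qed

lemma carrier_whomology_group: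
  "carrier (whomology_group t n X l) =
     (\<lambda>z. wboundaries t n X l #>\<^bsub>wcycle_group t n X l\<^esub> z) ` wcycles t n X l"
  by (auto simp: whomology_group_def FactGroup_def RCOSETS_def)

lemma wcoset_eqI:
  assumes "z \<in> wcycles t n X l" "w - z \<in> wboundaries t n X l"
  shows "wboundaries t n X l #>\<^bsub>wcycle_group t n X l\<^esub> w = wboundaries t n X l #>\<^bsub>wcycle_group t n X l\<^esub> z"
proof -
  interpret normal "wboundaries t n X l" "wcycle_group t n X l"
    by (rule normal_wboundaries)
  have "w \<in> wboundaries t n X l #>\<^bsub>wcycle_group t n X l\<^esub> z"
    using assms(2) by (auto simp: r_coset_def intro!: bexI[of _ "w - z"])
  then show ?thesis
    using repr_independence[OF _ _ subgroup_axioms] assms(1) by simp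
qed

section \<open>Functoriality and homotopy invariance\<close>

lemma wchain_map_wcycles:
  assumes "z \<in> wcycles t n X l" "W_continuous t X l X' l' f"
  shows "wchain_map n f z \<in> wcycles t n X' l'"
  using assms wchain_map_in[OF _ assms(2)] wboundary_wchain_map[of t n f z]
  by (auto simp: wcycles_iff) (simp add: wchain_map_def)

lemma wchain_map_wboundaries:
  assumes "b \<in> wboundaries t n X l" "W_continuous t X l X' l' f"
  shows "wchain_map n f b \<in> wboundaries t n X' l'"
proof -
  obtain c where c: "c \<in> carrier (wchain_group t (Suc n) X l)" "b = wboundary t (Suc n) c"
    using assms(1) by (auto simp: wboundaries_def)
  then have "wchain_map n f b = wboundary t (Suc n) (wchain_map (Suc n) f c)"
    by (simp add: wboundary_wchain_map)
  then show ?thesis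
    using wchain_map_in[OF c(1) assms(2)] by (simp add: wboundaries_def)
qed

text \<open>Representatives of a class differ by boundaries, which \<open>wchain_map n f\<close>
  sends to boundaries. All cosets in the union defining \<open>whom_induced\<close> therefore
  coincide.\<close>

lemma whom_induced_coset:
  assumes z: "z \<in> wcycles t n X l" and f: "W_continuous t X l X' l' f"
  shows "whom_induced t n X l X' l' f (wboundaries t n X l #>\<^bsub>wcycle_group t n X l\<^esub> z) =
    wboundaries t n X' l' #>\<^bsub>wcycle_group t n X' l'\<^esub> wchain_map n f z"
proof -
  interpret normal "wboundaries t n X l" "wcycle_group t n X l"
    by (rule normal_wboundaries)
  let ?C = "wboundaries t n X l #>\<^bsub>wcycle_group t n X l\<^esub> z"
  have "wboundaries t n X' l' #>\<^bsub>wcycle_group t n X' l'\<^esub> wchain_map n f c =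
      wboundaries t n X' l' #>\<^bsub>wcycle_group t n X' l'\<^esub> wchain_map n f z" if c: "c \<in> ?C" for c
  proof (rule wcoset_eqI[OF wchain_map_wcycles[OF z f]])
    obtain b where "b \<in> wboundaries t n X l" "c = b + z"
      using c by (auto simp: r_coset_def)
    then show "wchain_map n f c - wchain_map n f z \<in> wboundaries t n X' l'"
      using wchain_map_wboundaries[OF _ f] by (simp add: wchain_map_add)
  qed
  \<comment> \<open>A union of equal sets is that set only if the index set is nonempty.\<close>
  moreover have "?C \<noteq> {}"
    using rcos_self[OF _ subgroup_axioms] z by auto
  ultimately have "(\<Union>c\<in>?C. wboundaries t n X' l' #>\<^bsub>wcycle_group t n X' l'\<^esub> wchain_map n f c) =
      wboundaries t n X' l' #>\<^bsub>wcycle_group t n X' l'\<^esub> wchain_map n f z"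
    by (intro SUP_eq_const)
  moreover have "?C \<in> carrier (whomology_group t n X l)"
    using z by (auto simp: carrier_whomology_group)
  ultimately show ?thesis
    unfolding whom_induced_def by (simp only: restrict_apply')
qed

lemma whom_induced_hom:
  assumes f: "W_continuous t X l X' l' f"
  shows "whom_induced t n X l X' l' f \<in> hom (whomology_group t n X l) (whomology_group t n X' l')"
proof (rule homI)
  interpret N: normal "wboundaries t n X l" "wcycle_group t n X l"
    by (rule normal_wboundaries)
  interpret N': normal "wboundaries t n X' l'" "wcycle_group t n X' l'"
    by (rule normal_wboundaries)
  fix C assume "C \<in> carrier (whomology_group t n X l)"
  then obtain z where z: "z \<in> wcycles t n X l" "C = wboundaries t n X l #>\<^bsub>wcycle_group t n X l\<^esub> z"
    by (auto simp: carrier_whomology_group)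
  then show "whom_induced t n X l X' l' f C \<in> carrier (whomology_group t n X' l')"
    using whom_induced_coset[OF z(1) f] wchain_map_wcycles[OF z(1) f]
    by (simp add: carrier_whomology_group)
  fix D assume "D \<in> carrier (whomology_group t n X l)"
  then obtain w where w: "w \<in> wcycles t n X l" "D = wboundaries t n X l #>\<^bsub>wcycle_group t n X l\<^esub> w"
    by (auto simp: carrier_whomology_group)
  have zw: "z + w \<in> wcycles t n X l"
    using N.m_closed[of z w] z w by simp
  have "C \<otimes>\<^bsub>whomology_group t n X l\<^esub> D = wboundaries t n X l #>\<^bsub>wcycle_group t n X l\<^esub> (z + w)"
    using N.rcos_sum[of z w] z w by (simp add: whomology_group_def)
  moreover have "whom_induced t n X l X' l' f C \<otimes>\<^bsub>whomology_group t n X' l'\<^esub> whom_induced t n X l X' l' f D =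
      wboundaries t n X' l' #>\<^bsub>wcycle_group t n X' l'\<^esub> (wchain_map n f z + wchain_map n f w)"
    using N'.rcos_sum[of "wchain_map n f z" "wchain_map n f w"] z w f
    by (simp add: whomology_group_def whom_induced_coset wchain_map_wcycles)
  ultimately show "whom_induced t n X l X' l' f (C \<otimes>\<^bsub>whomology_group t n X l\<^esub> D) =
      whom_induced t n X l X' l' f C \<otimes>\<^bsub>whomology_group t n X' l'\<^esub> whom_induced t n X l X' l' f D"
    using whom_induced_coset[OF zw f] by (simp add: wchain_map_add)
qed

lemma whom_induced_id:
  assumes "C \<in> carrier (whomology_group t n X l)"
  shows "whom_induced t n X l X l id C = C"
proof -
  obtain z where z: "z \<in> wcycles t n X l" "C = wboundaries t n X l #>\<^bsub>wcycle_group t n X l\<^esub> z"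
    using assms by (auto simp: carrier_whomology_group)
  then have "wchain_map n id z = z"
    using wchain_map_id[of z t n X l] by (simp add: wcycles_iff)
  then show ?thesis
    using whom_induced_coset[OF z(1) W_continuous_id] by (simp add: z(2))
qed

lemma whom_induced_compose:
  assumes "W_continuous t X l X' l' f" "W_continuous t X' l' X'' l'' g"
    and "C \<in> carrier (whomology_group t n X l)"
  shows "whom_induced t n X' l' X'' l'' g (whom_induced t n X l X' l' f C) =
    whom_induced t n X l X'' l'' (g \<circ> f) C"
proof -
  obtain z where z: "z \<in> wcycles t n X l" "C = wboundaries t n X l #>\<^bsub>wcycle_group t n X l\<^esub> z"
    using assms(3) by (auto simp: carrier_whomology_group)
  show ?thesis
    unfolding z(2) whom_induced_coset[OF z(1) assms(1)]
      whom_induced_coset[OF wchain_map_wcycles[OF z(1) assms(1)] assms(2)]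
      whom_induced_coset[OF z(1) W_continuous_compose[OF assms(1,2)]] wchain_map_compose ..
qed

text \<open>On a cycle the prism of the boundary vanishes, so the prism identity exhibits the
  difference of the two images as a boundary.\<close>

lemma whom_induced_homotopic:
  assumes f: "W_continuous t X l X' l' f" and g: "W_continuous t X l X' l' g"
    and hom: "W_homotopic t X l X' l' f g"
  shows "whom_induced t n X l X' l' f = whom_induced t n X l X' l' g"
proof
  fix C
  obtain H where H: "W_continuous t (prod_topology X (top_of_set {0..1::real})) (\<lambda>(x, s). l x) X' l' H"
    and ends: "\<And>x. x \<in> topspace X \<Longrightarrow> H (x, 0) = f x \<and> H (x, 1) = g x"
    using hom unfolding W_homotopic_def by blast
  show "whom_induced t n X l X' l' f C = whom_induced t n X l X' l' g C"
  proof (cases "C \<in> carrier (whomology_group t n X l)")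
    case True
    then obtain z where z: "z \<in> wcycles t n X l" "C = wboundaries t n X l #>\<^bsub>wcycle_group t n X l\<^esub> z"
      by (auto simp: carrier_whomology_group)
    then have zc: "z \<in> carrier (wchain_group t n X l)" and "wboundary t n z = 0"
      by (auto simp: wcycles_iff)
    then have "wchain_map n g z - wchain_map n f z = wboundary t (Suc n) (prism n H z)"
      using prism_boundary[OF zc ends] by (simp add: prism_def)
    then have "wchain_map n g z - wchain_map n f z \<in> wboundaries t n X' l'"
      using prism_in[OF zc H] by (simp add: wboundaries_def)
    then show ?thesis
      using wcoset_eqI[OF wchain_map_wcycles[OF z(1) f]]
      by (simp add: z(2) whom_induced_coset[OF z(1)] f g)
  \<comment> \<open>Outside the carrier both restricted maps are \<open>undefined\<close>.\<close>
  qed (simp add: whom_induced_def)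
qed

text \<open>Functoriality reduces the composite to the map induced by \<open>g \<circ> f\<close>,
  and homotopy invariance to that of \<open>id\<close>. Exchanging the roles of \<open>f\<close> and
  \<open>g\<close> gives the other inverse law.\<close>

lemma whom_induced_inverse:
  assumes "W_continuous t X l X' l' f" "W_continuous t X' l' X l g"
    and "W_homotopic t X l X l (g \<circ> f) id" "C \<in> carrier (whomology_group t n X l)"
  shows "whom_induced t n X' l' X l g (whom_induced t n X l X' l' f C) = C"
  using assms by (simp add: whom_induced_compose whom_induced_id W_continuous_id
      W_continuous_compose whom_induced_homotopic[of t X l X l "g \<circ> f" id])

theorem proposition4p11:
  fixes X :: "'a topology" and l :: "'a \<Rightarrow> nat"
    and X' :: "'b topology" and l' :: "'b \<Rightarrow> nat"
    and t :: wtype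
  assumes "weighted_polyhedron TYPE('v) t X l"
    and "weighted_polyhedron TYPE('w) t X' l'"
  shows "(\<forall>f g. W_continuous t X l X' l' f \<and> W_continuous t X l X' l' g \<and>
             W_homotopic t X l X' l' f g \<longrightarrow>
             (\<forall>n. whom_induced t n X l X' l' f = whom_induced t n X l X' l' g)) \<and>
         (\<forall>f. W_homotopy_equivalence t X l X' l' f \<longrightarrow>
             (\<forall>n. whom_induced t n X l X' l' f
                    \<in> iso (whomology_group t n X l) (whomology_group t n X' l')))"
proof (intro conjI allI impI)
  fix f g n
  assume "W_continuous t X l X' l' f \<and> W_continuous t X l X' l' g \<and> W_homotopic t X l X' l' f g"
  then show "whom_induced t n X l X' l' f = whom_induced t n X l X' l' g"
    using whom_induced_homotopic by blast
next
  fix f n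
  assume "W_homotopy_equivalence t X l X' l' f"
  then obtain g where f: "W_continuous t X l X' l' f" and g: "W_continuous t X' l' X l g"
    and gf: "W_homotopic t X l X l (g \<circ> f) id" and fg: "W_homotopic t X' l' X' l' (f \<circ> g) id"
    unfolding W_homotopy_equivalence_def by blast
  have "bij_betw (whom_induced t n X l X' l' f)
      (carrier (whomology_group t n X l)) (carrier (whomology_group t n X' l'))"
    using whom_induced_inverse[OF f g gf] whom_induced_inverse[OF g f fg]
      hom_carrier[OF whom_induced_hom[OF f]] hom_carrier[OF whom_induced_hom[OF g]]
    by (intro bij_betw_byWitness[where f' = "whom_induced t n X' l' X l g"]) auto
  then show "whom_induced t n X l X' l' f \<in> iso (whomology_group t n X l) (whomology_group t n X' l')"
    using whom_induced_hom[OF f] by (simp add: iso_def)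
qed

end
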